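(* In the random graph setting described in the context, suppose there exist $\lambda_0>1$ and a function $p(\lambda)$ with $p(\lambda)\to 0$ as $\lambda\to\infty$ such that $$\mathbb P(R\in J(\lambda))\ge 1-p(\lambda)\qquad\text{for each } R\ge 1,\ \lambda\ge\lambda_0 .$$ Let $n\ge1$ (integer) and $R\ge 1$. Then, as $\theta\to\infty$, $$\mathbb P\Big(\theta^{-1}\le \frac{E^0_\omega\tau_R}{v(R)r(R)}\le\theta\Big)\to 1,$$ $$\mathbb P\big(\theta^{-1}\le v(\mathcal I(n))\,p^\omega_{2n}(0,0)\le\theta\big)\to 1,$$ $$P^*\Big(\frac{d(0,X_n)}{\mathcal I(n)}<\theta\Big)\to 1,$$ $$P^*\Big(\theta^{-1}<\frac{1+d(0,X_n)}{\mathcal I(n)}\Big)\to 1,$$ and in each case the convergence is uniform in $n\ge 1$ and $R\ge 1$.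
   Context: Random graphs. $(\Omega,\mathcal F,\mathbb P)$ is a probability space carrying a family of random graphs $\Gamma(\omega)=(G(\omega),E(\omega))$, $\omega\in\Omega$; for each $\omega$ the graph $\Gamma(\omega)$ is (unoriented) infinite, locally finite, connected, and contains a marked vertex $0$. $d=d_\omega$ is a metric on $G(\omega)$ (any metric, not necessarily the graph distance). $\mu_x$ is the number of edges containing $x$, extended to a measure $\mu$ on $G$; $B(x,R)=\{y:d(x,y)<R\}$, $B(R)=B(0,R)$, $V(R)=\mu(B(R))$. Random walk. $X=(X_n,n\ge0,P^x_\omega,x\in G(\omega))$ is the discrete-time simple random walk on $\Gamma(\omega)$ ($P^x_\omega(X_1=y)=1/\mu_x$ for $y\sim x$), with expectation $E^x_\omega$, and $p^\omega_n(x,y)=P^x_\omega(X_n=y)/\mu_y$. $\tau_R=\min\{n\ge0:X_n\notin B(R)\}$. The annealed law is $P^*=\mathbb P\times P^0_\omega$. Effective resistance. $\mathcal E(f,g)=\frac12\sum_{x\sim y}(f(x)-f(y))(g(x)-g(y))$ (sum over ordered pairs), $H^2=\{f\in\mathbb R^G:\mathcal E(f,f)<\infty\}$; for disjoint $A,B\subset G$, $R_{\rm eff}(A,B)^{-1}=\inf\{\mathcal E(f,f):f\in H^2,f|_A=1,f|_B=0\}$; $R_{\rm eff}(x,y)=R_{\rm eff}(\{x\},\{y\})$, $R_{\rm eff}(x,x)=0$. Growth functions. $v,r:[0,\infty]\to[0,\infty]$ are continuous strictly increasing functions with $v(0)=r(0)=0$, $v(1)=r(1)=1$, $v(\infty)=r(\infty)=\infty$,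 and for all $0<R'\le R<\infty$ $$C_1^{-1}(R/R')^{d_1}\le \frac{v(R)}{v(R')}\le C_1(R/R')^{d_2},\qquad C_2^{-1}(R/R')^{\alpha_1}\le \frac{r(R)}{r(R')}\le C_2(R/R')^{\alpha_2},$$ where $C_1,C_2\ge1$, $1\le d_1\le d_2$, $0<\alpha_1\le\alpha_2\le1$. $\mathcal I$ is the inverse function of $R\mapsto v(R)r(R)$. Good radii. For $\lambda>1$, $J(\lambda)$ is the (random) set of $R\in[1,\infty]$ such that $\lambda^{-1}v(R)\le V(R)\le\lambda v(R)$, $R_{\rm eff}(0,B(R)^c)\ge\lambda^{-1}r(R)$, and $R_{\rm eff}(0,y)\le\lambda r(d(0,y))$ for all $y\in B(R)$. *)

theory Defs
  imports "HOL-Probability.Probability"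
begin

section \<open>Graphs\<close>

text \<open>
  Unoriented simple graphs: a vertex set \<open>G\<close> and a set \<open>E\<close> of two-element subsets of \<open>G\<close>;
  \<open>x \<sim> y\<close> means \<open>{x, y} \<in> E\<close>.
\<close>

definition degree :: "'v set set \<Rightarrow> 'v \<Rightarrow> nat" where
  "degree E x = card {e \<in> E. x \<in> e}"

definition infinite_connected_graph :: "'v set \<Rightarrow> 'v set set \<Rightarrow> bool" where
  "infinite_connected_graph G E \<longleftrightarrow>
     E \<subseteq> {e. e \<subseteq> G \<and> card e = 2} \<and>
     infinite G \<and>
     (\<forall>x\<in>G. finite {e \<in> E. x \<in> e}) \<and>
     (\<forall>x\<in>G. \<forall>y\<in>G. (x, y) \<in> {(a, b). {a, b} \<in> E}\<^sup>*)"

definition vertex_measure :: "'v set \<Rightarrow> 'v set set \<Rightarrow> 'v measure" where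
  "vertex_measure G E = point_measure G (\<lambda>x. of_nat (degree E x))"

definition volume ::
    "'v set \<Rightarrow> 'v set set \<Rightarrow> ('v \<Rightarrow> 'v \<Rightarrow> real) \<Rightarrow> 'v \<Rightarrow> real \<Rightarrow> ennreal" where
  "volume G E d x R = emeasure (vertex_measure G E) (Metric_space.mball G d x R)"

section \<open>Effective resistance\<close>

text \<open>
  \<open>energy E f\<close> is \<open>\<E>(f, f)\<close>, half of a sum over ordered pairs, as an element of \<open>[0, \<infinity>]\<close>.
\<close>

definition energy :: "'v set set \<Rightarrow> ('v \<Rightarrow> real) \<Rightarrow> ennreal" where
  "energy E f =
     (\<integral>\<^sup>+(x, y). ennreal ((f x - f y)\<^sup>2) \<partial>count_space {(x, y). {x, y} \<in> E}) / 2"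

text \<open>
  The reciprocal is taken in \<open>[0, \<infinity>]\<close>, so infimum \<open>0\<close> gives resistance \<open>\<infinity>\<close>. If \<open>A\<close> and \<open>B\<close>
  intersect then no function is admissible, the infimum is \<open>\<infinity>\<close> and the resistance is \<open>0\<close>;
  this includes the convention that the resistance between \<open>x\<close> and \<open>x\<close> is \<open>0\<close>.
\<close>

definition eff_resistance :: "'v set set \<Rightarrow> 'v set \<Rightarrow> 'v set \<Rightarrow> ennreal" where
  "eff_resistance E A B =
     inverse (INF f\<in>{f. energy E f < \<infinity> \<and> (\<forall>x\<in>A. f x = 1) \<and> (\<forall>x\<in>B. f x = 0)}. energy E f)"

lemma eff_resistance_self: "eff_resistance E {x} {x} = 0"
proof -
  have "{f :: 'a \<Rightarrow> real. energy E f < \<infinity> \<and> (\<forall>y\<in>{x}. f y = 1) \<and> (\<forall>y\<in>{x}. f y = 0)} = {}"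
    by auto
  then show ?thesis
    unfolding eff_resistance_def by (simp only: image_empty Inf_empty top_ennreal_def[symmetric]) simp
qed

section \<open>Simple random walk\<close>

definition srw_step :: "'v set set \<Rightarrow> 'v \<Rightarrow> 'v pmf" where
  "srw_step E x = pmf_of_set {y. {x, y} \<in> E}"

text \<open>
  The law of the walk from \<open>x\<close>, on the space of vertex sequences, is the Ionescu-Tulcea measure
  of the one-step kernels; \<open>X n\<close> is the \<open>n\<close>-th coordinate.
\<close>

definition srw_kernel :: "'v set set \<Rightarrow> 'v \<Rightarrow> nat \<Rightarrow> (nat \<Rightarrow> 'v) \<Rightarrow> 'v measure" where
  "srw_kernel E x n w =
     measure_pmf (case n of 0 \<Rightarrow> return_pmf x | Suc m \<Rightarrow> srw_step E (w m))"

abbreviation path_space :: "(nat \<Rightarrow> 'v) measure" where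
  "path_space \<equiv> Pi\<^sub>M UNIV (\<lambda>_. count_space UNIV)"

definition srw_law :: "'v set set \<Rightarrow> 'v \<Rightarrow> (nat \<Rightarrow> 'v) measure" where
  "srw_law E x =
     projective_family.lim UNIV
       (Ionescu_Tulcea.CI (srw_kernel E x) (\<lambda>_. count_space UNIV)) (\<lambda>_. count_space UNIV)"

lemma Ionescu_Tulcea_srw: "Ionescu_Tulcea (srw_kernel E x) (\<lambda>_. count_space UNIV)"
proof (rule Ionescu_Tulcea.intro)
  show "srw_kernel E x i \<in> Pi\<^sub>M {0..<i} (\<lambda>_. count_space UNIV) \<rightarrow>\<^sub>M subprob_algebra (count_space UNIV)" for i
  proof (cases i)
    case 0
    then show ?thesis
      by (simp add: srw_kernel_def[abs_def] measure_pmf_in_subprob_space measurable_const)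
  next
    case (Suc m)
    have "(\<lambda>w. w m) \<in> Pi\<^sub>M {0..<Suc m} (\<lambda>_. count_space UNIV) \<rightarrow>\<^sub>M count_space UNIV"
      by (rule measurable_component_singleton) simp
    then have "(\<lambda>w. measure_pmf (srw_step E (w m)))
        \<in> Pi\<^sub>M {0..<Suc m} (\<lambda>_. count_space UNIV) \<rightarrow>\<^sub>M subprob_algebra (count_space UNIV)"
      by (rule measurable_compose) (simp add: measure_pmf_in_subprob_space)
    then show ?thesis
      by (simp add: Suc srw_kernel_def[abs_def])
  qed
qed (unfold srw_kernel_def, rule prob_space_measure_pmf)

definition heat_kernel :: "'v set set \<Rightarrow> nat \<Rightarrow> 'v \<Rightarrow> 'v \<Rightarrow> real" where
  "heat_kernel E n x y = \<P>(w in srw_law E x. w n = y) / real (degree E y)"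

text \<open>The first exit time is \<open>\<infinity>\<close>, the infimum of the empty set, if the path never leaves \<open>B\<close>.\<close>

definition exit_time :: "'v set \<Rightarrow> (nat \<Rightarrow> 'v) \<Rightarrow> ennreal" where
  "exit_time B w = (INF n\<in>{n. w n \<notin> B}. of_nat n)"

definition expected_exit_time ::
    "'v set \<Rightarrow> 'v set set \<Rightarrow> ('v \<Rightarrow> 'v \<Rightarrow> real) \<Rightarrow> 'v \<Rightarrow> real \<Rightarrow> ennreal" where
  "expected_exit_time G E d x R =
     (\<integral>\<^sup>+w. exit_time (Metric_space.mball G d x R) w \<partial>srw_law E x)"

section \<open>Random graphs\<close>

text \<open>
  The vertices are drawn from a fixed countable type (each graph is countable, being connected and
  locally finite), so measurability of the random graph means measurability of the root, of
  the indicators of vertices and edges, and of the distances. The values of \<open>d \<omega> x y\<close> outside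
  the vertex set are irrelevant conventions (for instance \<open>0\<close>).
\<close>

locale random_rooted_graph = prob_space M
  for M :: "'w measure" +
  fixes G :: "'w \<Rightarrow> ('v :: countable) set"
    and E :: "'w \<Rightarrow> 'v set set"
    and d :: "'w \<Rightarrow> 'v \<Rightarrow> 'v \<Rightarrow> real"
    and \<rho> :: "'w \<Rightarrow> 'v"
  assumes graph: "\<And>\<omega>. \<omega> \<in> space M \<Longrightarrow> infinite_connected_graph (G \<omega>) (E \<omega>)"
    and metric: "\<And>\<omega>. \<omega> \<in> space M \<Longrightarrow> Metric_space (G \<omega>) (d \<omega>)"
    and root_in: "\<And>\<omega>. \<omega> \<in> space M \<Longrightarrow> \<rho> \<omega> \<in> G \<omega>"
    and measurable_root: "\<rho> \<in> M \<rightarrow>\<^sub>M count_space UNIV"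
    and measurable_vertex: "\<And>x. {\<omega> \<in> space M. x \<in> G \<omega>} \<in> sets M"
    and measurable_edge: "\<And>x y. {\<omega> \<in> space M. {x, y} \<in> E \<omega>} \<in> sets M"
    and measurable_dist: "\<And>x y. (\<lambda>\<omega>. d \<omega> x y) \<in> borel_measurable M"

text \<open>The semidirect product of \<open>M\<close> with the quenched laws of the walk started at the root.\<close>

definition annealed_law ::
    "'w measure \<Rightarrow> ('w \<Rightarrow> 'v set set) \<Rightarrow> ('w \<Rightarrow> 'v) \<Rightarrow> ('w \<times> (nat \<Rightarrow> 'v)) measure" where
  "annealed_law M E \<rho> =
     M \<bind> (\<lambda>\<omega>. distr (srw_law (E \<omega>) (\<rho> \<omega>)) (M \<Otimes>\<^sub>M path_space) (Pair \<omega>))"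

section \<open>Growth functions and good radii\<close>

text \<open>
  Growth functions are given by their restriction to \<open>[0, \<infinity>)\<close>. The values there are finite by
  strict monotonicity, and for \<open>a > 0\<close> the lower bound makes \<open>f\<close> tend to \<open>\<infinity>\<close>, so the
  extension by \<open>f \<infinity> = \<infinity>\<close> is continuous and strictly increasing on \<open>[0, \<infinity>]\<close>.
\<close>

definition growth_function :: "(real \<Rightarrow> real) \<Rightarrow> real \<Rightarrow> real \<Rightarrow> real \<Rightarrow> bool" where
  "growth_function f C a b \<longleftrightarrow>
     continuous_on {0..} f \<and> strict_mono_on {0..} f \<and> f 0 = 0 \<and> f 1 = 1 \<and>
     (\<forall>R' R. 0 < R' \<and> R' \<le> R \<longrightarrow>
        inverse C * (R / R') powr a \<le> f R / f R' \<and> f R / f R' \<le> C * (R / R') powr b)"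

definition scale_inverse :: "(real \<Rightarrow> real) \<Rightarrow> (real \<Rightarrow> real) \<Rightarrow> real \<Rightarrow> real" where
  "scale_inverse v r = inv_into {0..} (\<lambda>R. v R * r R)"

text \<open>Only finite radii are recorded; the radius \<open>\<infinity>\<close> is never tested for membership.\<close>

definition good_radii ::
    "'v set \<Rightarrow> 'v set set \<Rightarrow> ('v \<Rightarrow> 'v \<Rightarrow> real) \<Rightarrow> 'v \<Rightarrow>
     (real \<Rightarrow> real) \<Rightarrow> (real \<Rightarrow> real) \<Rightarrow> real \<Rightarrow> real set" where
  "good_radii G E d x v r lam =
     {R. 1 \<le> R \<and>
         ennreal (inverse lam * v R) \<le> volume G E d x R \<and>
         volume G E d x R \<le> ennreal (lam * v R) \<and>
         eff_resistance E {x} (G - Metric_space.mball G d x R) \<ge> ennreal (inverse lam * r R) \<and>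
         (\<forall>y \<in> Metric_space.mball G d x R. eff_resistance E {x} {y} \<le> ennreal (lam * r (d x y)))}"

end

theory Submission
  imports Defs
begin

text \<open>
  Everything rests on one deterministic estimate for the Green function of a single graph up to a
  finite time. Let \<open>u\<^sub>k\<close> be the transition density, with respect to the degrees, of the walk from
  the root \<open>o\<close> killed on leaving a set \<open>B\<close>, and \<open>G\<^sub>n = u\<^sub>0 + \<dots> + u\<^bsub>n-1\<^esub>\<close>. The sum telescopes under the
  Laplacian, so \<open>G\<^sub>n\<close> solves the Poisson equation with right-hand side \<open>\<delta>\<^sub>o - \<mu> u\<^sub>n\<close> on \<open>B\<close>
  (\<open>laplacian_green\<close>), and pairing this equation with \<open>G\<^sub>n\<close> itself gives \<open>\<E>(G\<^sub>n, G\<^sub>n) \<le> G\<^sub>n(o)\<close>. By the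
  definition of effective resistance \<open>G\<^sub>n(o)\<close> and \<open>G\<^sub>n(y)\<close> then differ by at most the square root of
  \<open>R\<^sub>e\<^sub>f\<^sub>f(o, y) G\<^sub>n(o)\<close> (\<open>green_diff_le\<close>). The total mass of \<open>G\<^sub>n\<close> is at most \<open>n\<close>, so if \<open>S\<close> is a good
  radius, \<open>G\<^sub>n\<close> is at most of order \<open>n / v(S)\<close> somewhere in \<open>B(S)\<close>, hence \<open>G\<^sub>n(o)\<close> is at most of order
  \<open>n / v(S) + r(S)\<close> (\<open>green_root_le_good\<close>). At the natural time scale \<open>n \<approx> v(S) r(S)\<close> this is the
  order of \<open>r(S)\<close>.

  The rest follows from it quickly.
  \<^item> Pairing the Poisson equation with a function of small energy that is \<open>1\<close> at the root and \<open>0\<close> off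
    \<open>B(R)\<close>, Cauchy-Schwarz bounds the squared probability of leaving \<open>B(R)\<close> by time \<open>n\<close> by
    \<open>G\<^sub>n(o) / R\<^sub>e\<^sub>f\<^sub>f(o, B(R)\<^sup>c)\<close>, which is at most of order \<open>r(S) / r(R)\<close> (\<open>exit_probability_le_good\<close>). This
    gives the upper bound for the displacement with \<open>R = \<theta> S\<close>, and the lower bound for the expected
    exit time from \<open>B(R)\<close>.
  \<^item> For the upper bound on the expected exit time, \<open>G\<^sub>n\<close> killed off \<open>B(R)\<close> vanishes at some point of
    a larger good ball, so it is at most of order \<open>r(R)\<close> uniformly in \<open>n\<close>; sum it over \<open>B(R)\<close>
    (\<open>exit_time_le_good\<close>).
  \<^item> Without killing, \<open>p\<^bsub>2n\<^esub>(o, o)\<close> decreases in \<open>n\<close>, so \<open>n p\<^bsub>2n\<^esub>(o, o) \<le> G\<^bsub>2n+1\<^esub>(o)\<close>, which is the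
    upper heat kernel bound (\<open>heat_upper_good\<close>).
  \<^item> Cauchy-Schwarz gives \<open>P(X\<^sub>n \<in> A)\<^sup>2 \<le> \<mu>(A) p\<^bsub>2n\<^esub>(o, o)\<close> (\<open>walk_in_le\<close>). For \<open>A\<close> a large ball this is
    the lower heat kernel bound; for \<open>A\<close> a small ball, with the upper heat kernel bound, it is the
    lower bound for the displacement.

  Randomness enters only through union bounds. Fix \<open>\<lambda>\<close> so that each radius is good with probability at
  least \<open>1 - \<delta>\<close>. Once \<open>\<theta>\<close> exceeds a bound that depends on \<open>\<lambda>\<close>, \<open>\<delta>\<close> and the growth functions alone, each
  of the four events holds whenever two or three suitable radii are good; for the two displacement
  events this costs a further quenched probability \<open>\<delta>\<close>. This is where uniformity in \<open>n\<close> and \<open>R\<close> comes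
  from. The remaining work is to compute with the Ionescu-Tulcea law of the walk and to see that it
  depends measurably on the environment.
\<close>

section \<open>Finite-dimensional laws of the walk\<close>

abbreviation paths_upto :: "nat \<Rightarrow> (nat \<Rightarrow> 'v) measure" where
  "paths_upto n \<equiv> Pi\<^sub>M {0..<n} (\<lambda>_. count_space UNIV)"

lemma space_path_space [simp]: "space path_space = UNIV"
  by (simp add: space_PiM PiE_def extensional_def)

lemma sets_paths_upto:
  fixes A :: "(nat \<Rightarrow> 'v::countable) set"
  shows "A \<in> sets (paths_upto n) \<longleftrightarrow> A \<subseteq> {0..<n} \<rightarrow>\<^sub>E UNIV"
  by (subst count_space_PiM_finite) auto

lemma sets_walk_at: "{w. Q (w n)} \<in> sets (path_space :: (nat \<Rightarrow> 'v) measure)"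
proof -
  have "(\<lambda>w. w n) \<in> path_space \<rightarrow>\<^sub>M count_space (UNIV :: 'v set)" by measurable
  from measurable_sets[OF this, of "Collect Q"] show ?thesis by (simp add: vimage_def)
qed

text \<open>
  Events of the past are events because the marginal on finitely many coordinates lives on a
  countable set with the discrete \<open>\<sigma>\<close>-algebra.
\<close>

lemma sets_past:
  fixes Q :: "(nat \<Rightarrow> 'v::countable) \<Rightarrow> bool"
  assumes Q: "\<And>w w'. (\<And>i. i \<le> n \<Longrightarrow> w i = w' i) \<Longrightarrow> Q w = Q w'"
  shows "{w. Q w \<and> w n = z} \<in> sets path_space"
proof -
  let ?X = "{w \<in> {0..<Suc n} \<rightarrow>\<^sub>E UNIV. Q w \<and> w n = z}"
  have "Q (restrict w {0..<Suc n}) = Q w" for w by (intro Q) auto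
  then have "{w. Q w \<and> w n = z} = (\<lambda>w. restrict w {0..<Suc n}) -` ?X \<inter> space path_space"
    by auto
  also have "\<dots> \<in> sets path_space"
    by (rule measurable_sets[OF measurable_restrict_subset[of "{0..<Suc n}" UNIV]])
      (auto simp: sets_paths_upto)
  finally show ?thesis .
qed

context
  fixes E :: "'v::countable set set" and x :: 'v
begin

interpretation IT: Ionescu_Tulcea "srw_kernel E x" "\<lambda>_. count_space UNIV"
  by (rule Ionescu_Tulcea_srw)

lemma sets_srw_law [simp, measurable_cong]: "sets (srw_law E x) = sets path_space"
  unfolding srw_law_def by simp

lemma space_srw_law [simp]: "space (srw_law E x) = UNIV"
  using sets_eq_imp_space_eq[OF sets_srw_law] by simp

lemma measurable_restrict_upto: "(\<lambda>w. restrict w {0..<n}) \<in> srw_law E x \<rightarrow>\<^sub>M paths_upto n"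
  unfolding measurable_cong_sets[OF sets_srw_law refl] by (rule measurable_restrict_subset) simp

text \<open>
  The marginals of the projective limit are the iterated kernels from which it was built, so
  probabilities can be computed one step at a time.
\<close>

lemma distr_srw_law: "distr (srw_law E x) (paths_upto n) (\<lambda>w. restrict w {0..<n}) = IT.C 0 n (\<lambda>_. undefined)"
proof -
  have "distr (srw_law E x) (paths_upto n) (\<lambda>w. restrict w {0..<n}) = IT.CI {0..<n}"
    unfolding srw_law_def by (rule IT.distr_lim) simp
  also have "\<dots> = IT.C 0 n (\<lambda>_. undefined)"
  proof (rule measure_eqI)
    show "sets (IT.CI {0..<n}) = sets (IT.C 0 n (\<lambda>_. undefined))"
      by (simp add: IT.CI_def IT.sets_C)
  next
    fix X assume "X \<in> sets (IT.CI {0..<n})"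
    then have X: "X \<in> sets (paths_upto n)" by (simp add: IT.CI_def)
    then have "prod_emb {0..<n} (\<lambda>_. count_space UNIV) {0..<n} X = X"
      using sets.sets_into_space[OF X] by (intro prod_emb_id) (simp add: space_PiM)
    then show "emeasure (IT.CI {0..<n}) X = emeasure (IT.C 0 n (\<lambda>_. undefined)) X"
      using IT.emeasure_CI[OF order_refl X] by simp
  qed
  finally show ?thesis .
qed

lemma prob_space_srw_law: "prob_space (srw_law E x)"
proof (rule prob_space_distrD)
  show "(\<lambda>w. restrict w {0..<0}) \<in> srw_law E x \<rightarrow>\<^sub>M paths_upto 0"
    by (rule measurable_restrict_upto)
  show "prob_space (distr (srw_law E x) (paths_upto 0) (\<lambda>w. restrict w {0..<0}))"
    unfolding distr_srw_law by (rule IT.prob_space_C) (simp add: space_PiM)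
qed

lemma emeasure_srw_law_start: "emeasure (srw_law E x) {w. w 0 = y} = indicator {x} y"
proof -
  let ?X = "{w \<in> {0..<Suc 0} \<rightarrow>\<^sub>E UNIV. w 0 = y}"
  have X: "?X \<in> sets (paths_upto (Suc 0))" by (subst sets_paths_upto) auto
  have "emeasure (srw_law E x) {w. w 0 = y}
      = emeasure (distr (srw_law E x) (paths_upto (Suc 0)) (\<lambda>w. restrict w {0..<Suc 0})) ?X"
    by (subst emeasure_distr[OF measurable_restrict_upto X]) (auto intro!: arg_cong[where f="emeasure _"])
  also have "\<dots> = emeasure (IT.eP 0 (\<lambda>_. undefined)) ?X"
    unfolding distr_srw_law using bind_return[OF IT.measurable_eP, of "\<lambda>_. undefined" 0]
    by (simp add: space_PiM)
  also have "\<dots> = indicator {x} y"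
    by (subst IT.emeasure_eP[OF _ X])
       (auto simp: srw_kernel_def emeasure_return_pmf indicator_def split: if_splits)
  finally show ?thesis .
qed

text \<open>
  The Markov property at time \<open>n\<close>; \<open>Q\<close> ranges over the events of the past.
\<close>

lemma emeasure_srw_law_Suc:
  assumes Q: "\<And>w w'. (\<And>i. i \<le> n \<Longrightarrow> w i = w' i) \<Longrightarrow> Q w = Q w'"
  shows "emeasure (srw_law E x) {w. Q w \<and> w (Suc n) = y} =
    (\<integral>\<^sup>+z. ennreal (pmf (srw_step E z) y) * emeasure (srw_law E x) {w. Q w \<and> w n = z} \<partial>count_space UNIV)"
proof -
  let ?m = "Suc n"
  let ?C = "IT.C 0 ?m (\<lambda>_. undefined)"
  let ?X = "{w \<in> {0..<Suc ?m} \<rightarrow>\<^sub>E UNIV. Q w \<and> w ?m = y}"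
  have Qr: "Q (restrict w {0..<k}) = Q w" if "n < k" for w k
    using that by (intro Q) auto
  have [measurable]: "{w. Q w \<and> w n = z} \<in> sets path_space" for z
    by (rule sets_past) (rule Q)
  have X: "?X \<in> sets (paths_upto (Suc ?m))" by (subst sets_paths_upto) auto
  have "emeasure (srw_law E x) {w. Q w \<and> w ?m = y}
      = emeasure (distr (srw_law E x) (paths_upto (Suc ?m)) (\<lambda>w. restrict w {0..<Suc ?m})) ?X"
    by (subst emeasure_distr[OF measurable_restrict_upto X]) (auto simp: Qr intro!: arg_cong[where f="emeasure _"])
  also have "\<dots> = emeasure (?C \<bind> IT.eP ?m) ?X"
    unfolding distr_srw_law by simp
  also have "\<dots> = (\<integral>\<^sup>+w. emeasure (IT.eP ?m w) ?X \<partial>?C)"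
  proof (rule emeasure_bind[OF _ _ X])
    show "IT.eP ?m \<in> ?C \<rightarrow>\<^sub>M subprob_algebra (paths_upto (Suc ?m))"
      using IT.measurable_eP[of ?m] IT.sets_C[of "\<lambda>_. undefined" 0 ?m]
      by (subst measurable_cong_sets[OF _ refl]) auto
  qed (simp add: IT.space_C space_PiM PiE_eq_empty_iff del: IT.C.simps)
  also have "\<dots> = (\<integral>\<^sup>+w. indicator {w. Q w} w * ennreal (pmf (srw_step E (w n)) y) \<partial>?C)"
  proof (rule nn_integral_cong)
    fix w assume "w \<in> space ?C"
    then have w: "w \<in> space (paths_upto ?m)" by (simp add: IT.space_C del: IT.C.simps)
    have "Q (w(?m := a)) = Q w" for a by (intro Q) auto
    then have "(\<lambda>a. w(?m := a)) -` ?X = (if Q w then {y} else {})"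
      using w by (auto simp: space_PiM PiE_def extensional_def)
    then show "emeasure (IT.eP ?m w) ?X = indicator {w. Q w} w * ennreal (pmf (srw_step E (w n)) y)"
      by (subst IT.emeasure_eP[OF w X]) (auto simp: srw_kernel_def emeasure_pmf_single)
  qed
  also have "\<dots> = (\<integral>\<^sup>+w. indicator {w. Q w} (restrict w {0..<?m}) *
      ennreal (pmf (srw_step E (restrict w {0..<?m} n)) y) \<partial>srw_law E x)"
    unfolding distr_srw_law[symmetric]
    by (rule nn_integral_distr[OF measurable_restrict_upto]) (simp add: count_space_PiM_finite)
  also have "\<dots> = (\<integral>\<^sup>+w. (\<integral>\<^sup>+z. ennreal (pmf (srw_step E z) y) * indicator {w. Q w \<and> w n = z} w \<partial>count_space UNIV) \<partial>srw_law E x)"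
  proof (rule nn_integral_cong)
    fix w
    have "(\<integral>\<^sup>+z. ennreal (pmf (srw_step E z) y) * indicator {w. Q w \<and> w n = z} w \<partial>count_space UNIV)
      = (\<integral>\<^sup>+z. (ennreal (pmf (srw_step E (w n)) y) * indicator {w. Q w} w) * indicator {w n} z \<partial>count_space UNIV)"
      by (rule nn_integral_cong) (auto simp: indicator_def)
    also have "\<dots> = ennreal (pmf (srw_step E (w n)) y) * indicator {w. Q w} w"
      by (subst nn_integral_cmult_indicator) auto
    finally show "indicator {w. Q w} (restrict w {0..<?m}) * ennreal (pmf (srw_step E (restrict w {0..<?m} n)) y)
      = (\<integral>\<^sup>+z. ennreal (pmf (srw_step E z) y) * indicator {w. Q w \<and> w n = z} w \<partial>count_space UNIV)"
      by (simp add: indicator_def Qr mult.commute)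
  qed
  also have "\<dots> = (\<integral>\<^sup>+z. (\<integral>\<^sup>+w. ennreal (pmf (srw_step E z) y) * indicator {w. Q w \<and> w n = z} w \<partial>srw_law E x) \<partial>count_space UNIV)"
    by (rule nn_integral_count_space_nn_integral) auto
  also have "\<dots> = (\<integral>\<^sup>+z. ennreal (pmf (srw_step E z) y) * emeasure (srw_law E x) {w. Q w \<and> w n = z} \<partial>count_space UNIV)"
    by (intro nn_integral_cong nn_integral_cmult_indicator) auto
  finally show ?thesis .
qed

end

section \<open>The walk killed on leaving a set\<close>

definition nbrs :: "'v set set \<Rightarrow> 'v \<Rightarrow> 'v set" where
  "nbrs E x = {y. {x, y} \<in> E}"

locale rooted_graph =
  fixes G :: "'v::countable set" and E :: "'v set set" and x\<^sub>0 :: 'v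
  assumes graph: "infinite_connected_graph G E" and root: "x\<^sub>0 \<in> G"
begin

lemma edgeD: "{x, y} \<in> E \<Longrightarrow> x \<in> G \<and> y \<in> G \<and> x \<noteq> y"
  using graph unfolding infinite_connected_graph_def by (cases "x = y") auto

lemma nbrs_sym: "x \<in> nbrs E y \<longleftrightarrow> y \<in> nbrs E x"
  by (simp add: nbrs_def insert_commute)

lemma nbrs_outside: "x \<notin> G \<Longrightarrow> nbrs E x = {}"
  using edgeD by (auto simp: nbrs_def)

lemma edges_at: "{e \<in> E. x \<in> e} = (\<lambda>y. {x, y}) ` nbrs E x"
proof (intro set_eqI iffI)
  fix e assume "e \<in> {e \<in> E. x \<in> e}"
  then have e: "e \<in> E" "x \<in> e" and "card e = 2"
    using graph unfolding infinite_connected_graph_def by auto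
  then obtain a b where "e = {a, b}" by (auto simp: card_2_iff)
  with e show "e \<in> (\<lambda>y. {x, y}) ` nbrs E x" by (auto simp: nbrs_def insert_commute)
qed (auto simp: nbrs_def)

lemma inj_edges_at: "inj_on (\<lambda>y. {x, y}) (nbrs E x)"
  by (auto simp: inj_on_def doubleton_eq_iff)

lemma finite_nbrs [simp]: "finite (nbrs E x)"
proof (cases "x \<in> G")
  case True
  then have "finite {e \<in> E. x \<in> e}"
    using graph unfolding infinite_connected_graph_def by auto
  then show ?thesis unfolding edges_at using inj_edges_at finite_imageD by blast
qed (simp add: nbrs_outside)

lemma degree_eq: "degree E x = card (nbrs E x)"
  unfolding degree_def edges_at by (rule card_image[OF inj_edges_at])

lemma nbrs_nonempty: "x \<in> G \<Longrightarrow> nbrs E x \<noteq> {}"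
proof -
  assume x: "x \<in> G"
  have "infinite G" using graph unfolding infinite_connected_graph_def by auto
  then obtain y where y: "y \<in> G" "y \<noteq> x"
    by (metis finite.emptyI finite_insert finite_subset insertCI subsetI)
  then have "(x, y) \<in> {(a, b). {a, b} \<in> E}\<^sup>*"
    using graph x unfolding infinite_connected_graph_def by auto
  then show ?thesis using y(2) by (cases rule: converse_rtranclE) (auto simp: nbrs_def)
qed

lemma degree_ge_1: "x \<in> G \<Longrightarrow> 1 \<le> degree E x"
  unfolding degree_eq using nbrs_nonempty[of x] by (simp add: Suc_le_eq card_gt_0_iff)

lemma degree_outside: "x \<notin> G \<Longrightarrow> degree E x = 0"
  by (simp add: degree_eq nbrs_outside)

lemma pmf_srw_step: "x \<in> G \<Longrightarrow> pmf (srw_step E x) y = indicator (nbrs E x) y / degree E x"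
  unfolding srw_step_def degree_eq nbrs_def[symmetric] by (subst pmf_of_set) (auto simp: nbrs_nonempty)

text \<open>
  The transition density \<open>P(X\<^sub>i \<in> B for i \<le> n, X\<^sub>n = y) / \<mu>\<^sub>y\<close> of the walk from the root, provided
  that the root lies in \<open>B\<close> (\<open>emeasure_killed\<close>). Dividing by the degree makes the one-step operator
  the average over neighbours, which is symmetric with respect to the degrees.
\<close>

primrec killed :: "'v set \<Rightarrow> nat \<Rightarrow> 'v \<Rightarrow> real" where
  "killed B 0 y = indicator {x\<^sub>0} y / degree E y"
| "killed B (Suc n) y = indicator B y * (\<Sum>z\<in>nbrs E y. killed B n z) / degree E y"

lemma killed_nonneg: "0 \<le> killed B n y"
  by (induction n arbitrary: y) (auto intro!: sum_nonneg divide_nonneg_nonneg mult_nonneg_nonneg)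

lemma killed_outside: "x\<^sub>0 \<in> B \<Longrightarrow> y \<notin> B \<Longrightarrow> killed B n y = 0"
  by (cases n) (auto split: split_indicator)

lemma killed_outside_graph: "y \<notin> G \<Longrightarrow> killed B n y = 0"
  by (cases n) (auto simp: degree_outside)

text \<open>
  In a locally finite graph the walk has finitely many possible positions at a given time, so sums
  against the density can be taken over finite sets.
\<close>

lemma finite_support_killed: "finite {y. killed B n y \<noteq> 0}"
proof (induction n)
  case 0
  have "{y. killed B 0 y \<noteq> 0} \<subseteq> {x\<^sub>0}" by (auto split: split_indicator_asm)
  then show ?case by (rule finite_subset) simp
next
  case (Suc n)
  have "{y. killed B (Suc n) y \<noteq> 0} \<subseteq> (\<Union>z\<in>{y. killed B n y \<noteq> 0}. nbrs E z)"
  proof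
    fix y assume "y \<in> {y. killed B (Suc n) y \<noteq> 0}"
    then have "(\<Sum>z\<in>nbrs E y. killed B n z) \<noteq> 0" by auto
    then obtain z where "z \<in> nbrs E y" "killed B n z \<noteq> 0" by (meson sum.neutral)
    then show "y \<in> (\<Union>z\<in>{y. killed B n y \<noteq> 0}. nbrs E z)" using nbrs_sym by auto
  qed
  then show ?case by (rule finite_subset) (use Suc in auto)
qed

text \<open>
  A step from \<open>z\<close> to a neighbour has probability \<open>1 / \<mu>\<^sub>z\<close>, which cancels the degree in
  \<open>P(X\<^sub>n = z) = \<mu>\<^sub>z u\<^sub>n(z)\<close>: the Markov property turns into the recursion that defines the density.
\<close>

lemma emeasure_killed:
  assumes B: "x\<^sub>0 \<in> B"
  shows "emeasure (srw_law E x\<^sub>0) {w. (\<forall>i\<le>n. w i \<in> B) \<and> w n = y} = ennreal (degree E y * killed B n y)"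
proof (induction n arbitrary: y)
  case 0
  have "{w. (\<forall>i\<le>0. w i \<in> B) \<and> w 0 = y} = (if y \<in> B then {w::nat \<Rightarrow> 'v. w 0 = y} else {})" by auto
  with B degree_ge_1[OF root] show ?case by (auto simp: emeasure_srw_law_start indicator_def)
next
  case (Suc n)
  let ?Q = "\<lambda>w. \<forall>i\<le>n. w i \<in> B"
  let ?\<mu> = "srw_law E x\<^sub>0"
  show ?case
  proof (cases "y \<in> B")
    case False
    then have "{w. (\<forall>i\<le>Suc n. w i \<in> B) \<and> w (Suc n) = y} = {}" by auto
    with False show ?thesis by (simp only:) simp
  next
    case True
    then have "{w. (\<forall>i\<le>Suc n. w i \<in> B) \<and> w (Suc n) = y} = {w. ?Q w \<and> w (Suc n) = y}"
      by (auto simp: le_Suc_eq)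
    then have "emeasure ?\<mu> {w. (\<forall>i\<le>Suc n. w i \<in> B) \<and> w (Suc n) = y}
       = (\<integral>\<^sup>+z. ennreal (pmf (srw_step E z) y) * emeasure ?\<mu> {w. ?Q w \<and> w n = z} \<partial>count_space UNIV)"
      by (simp only:) (rule emeasure_srw_law_Suc, auto)
    also have "\<dots> = (\<integral>\<^sup>+z. ennreal (killed B n z) * indicator (nbrs E y) z \<partial>count_space UNIV)"
    proof (rule nn_integral_cong)
      fix z
      show "ennreal (pmf (srw_step E z) y) * emeasure ?\<mu> {w. ?Q w \<and> w n = z} = ennreal (killed B n z) * indicator (nbrs E y) z"
      proof (cases "z \<in> G")
        case True
        then have "pmf (srw_step E z) y * (degree E z * killed B n z) = killed B n z * indicator (nbrs E y) z"
          using degree_ge_1[OF True] nbrs_sym[of z y] by (simp add: pmf_srw_step indicator_def)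
        then show ?thesis unfolding Suc
          by (subst ennreal_mult[symmetric]) (auto simp: killed_nonneg indicator_def)
      next
        case False then show ?thesis unfolding Suc by (simp add: killed_outside_graph)
      qed
    qed
    also have "\<dots> = (\<Sum>z\<in>nbrs E y. ennreal (killed B n z))"
      by (subst nn_integral_count_space_indicator[symmetric]) (auto simp: nn_integral_count_space_finite)
    also have "\<dots> = ennreal (\<Sum>z\<in>nbrs E y. killed B n z)"
      by (simp add: sum_ennreal killed_nonneg)
    also have "(\<Sum>z\<in>nbrs E y. killed B n z) = degree E y * killed B (Suc n) y"
      using True degree_eq[of y] by (cases "nbrs E y = {}") auto
    finally show ?thesis .
  qed
qed

lemma emeasure_killed_sum:
  assumes B: "x\<^sub>0 \<in> B" and F: "finite F" "\<And>y. y \<notin> F \<Longrightarrow> killed B n y = 0"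
  shows "emeasure (srw_law E x\<^sub>0) {w. \<forall>i\<le>n. w i \<in> B} = ennreal (\<Sum>y\<in>F. degree E y * killed B n y)"
proof -
  let ?\<mu> = "srw_law E x\<^sub>0"
  have [measurable]: "{w. (\<forall>i\<le>n. w i \<in> B) \<and> w n = z} \<in> sets path_space" for z
    by (rule sets_past) auto
  have "emeasure ?\<mu> {w. \<forall>i\<le>n. w i \<in> B} = emeasure ?\<mu> (\<Union>z\<in>UNIV. {w. (\<forall>i\<le>n. w i \<in> B) \<and> w n = z})"
    by (rule arg_cong[where f="emeasure _"]) auto
  also have "\<dots> = (\<integral>\<^sup>+z. emeasure ?\<mu> {w. (\<forall>i\<le>n. w i \<in> B) \<and> w n = z} \<partial>count_space UNIV)"
    by (rule emeasure_UN_countable) (auto simp: disjoint_family_on_def)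
  also have "\<dots> = (\<Sum>y\<in>F. ennreal (degree E y * killed B n y))"
    unfolding emeasure_killed[OF B] using F by (subst nn_integral_count_space'[where A=F]) auto
  also have "\<dots> = ennreal (\<Sum>y\<in>F. degree E y * killed B n y)"
    by (rule sum_ennreal) (simp add: killed_nonneg)
  finally show ?thesis .
qed

end

section \<open>Dirichlet form and effective resistance\<close>

context rooted_graph
begin

text \<open>
  The Dirichlet form is truncated to the oriented edges with an endpoint in a finite set \<open>F\<close>.
  For a function supported in \<open>F\<close> nothing is lost, and for any other one the truncated energy is a
  lower bound. Bilinearity and Cauchy-Schwarz then concern finite sums only.
\<close>

definition edges_meeting :: "'v set \<Rightarrow> ('v \<times> 'v) set" where
  "edges_meeting F = {(x, y). {x, y} \<in> E \<and> (x \<in> F \<or> y \<in> F)}"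

definition dirichlet :: "'v set \<Rightarrow> ('v \<Rightarrow> real) \<Rightarrow> ('v \<Rightarrow> real) \<Rightarrow> real" where
  "dirichlet F f g = (\<Sum>(x, y)\<in>edges_meeting F. (f x - f y) * (g x - g y)) / 2"

lemma finite_edges_meeting: "finite F \<Longrightarrow> finite (edges_meeting F)"
proof -
  assume "finite F"
  then have "finite (Sigma F (nbrs E) \<union> (Sigma F (nbrs E))\<inverse>)" by auto
  moreover have "edges_meeting F \<subseteq> Sigma F (nbrs E) \<union> (Sigma F (nbrs E))\<inverse>"
    by (auto simp: edges_meeting_def nbrs_def insert_commute)
  ultimately show ?thesis by (rule finite_subset[rotated])
qed

lemma dirichlet_nonneg: "0 \<le> dirichlet F f f"
  unfolding dirichlet_def by (intro divide_nonneg_nonneg sum_nonneg) auto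

text \<open>
  Summation by parts: reversing all edges shows that the two halves of \<open>g x - g y\<close> contribute
  equally, and the one with \<open>g x\<close> only sees edges starting in \<open>F\<close>.
\<close>

lemma Green_formula:
  assumes F: "finite F" "\<And>x. x \<notin> F \<Longrightarrow> g x = 0"
  shows "dirichlet F h g = (\<Sum>x\<in>F. g x * (\<Sum>y\<in>nbrs E x. h x - h y))"
proof -
  let ?D = "edges_meeting F"
  note fin = finite_edges_meeting[OF F(1)]
  have swap: "(\<Sum>(x, y)\<in>?D. (h x - h y) * g y) = (\<Sum>(x, y)\<in>?D. (h y - h x) * g x)"
    by (rule sum.reindex_bij_witness[of _ prod.swap prod.swap])
       (auto simp: edges_meeting_def insert_commute)
  have "(\<Sum>(x, y)\<in>?D. (h x - h y) * (g x - g y))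
      = (\<Sum>(x, y)\<in>?D. (h x - h y) * g x) - (\<Sum>(x, y)\<in>?D. (h x - h y) * g y)"
    unfolding sum_subtractf[symmetric] by (intro sum.cong) (auto simp: algebra_simps)
  also have "\<dots> = 2 * (\<Sum>(x, y)\<in>?D. (h x - h y) * g x)"
    unfolding swap by (simp add: sum_subtractf[symmetric] sum_distrib_left) (intro sum.cong, auto simp: algebra_simps sum_subtractf[symmetric])
  also have "(\<Sum>(x, y)\<in>?D. (h x - h y) * g x) = (\<Sum>(x, y)\<in>Sigma F (nbrs E). (h x - h y) * g x)"
    by (rule sum.mono_neutral_right[OF fin]) (auto simp: edges_meeting_def nbrs_def intro: F(2))
  also have "\<dots> = (\<Sum>x\<in>F. \<Sum>y\<in>nbrs E x. (h x - h y) * g x)"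
    using F(1) by (subst sum.Sigma) auto
  finally show ?thesis
    unfolding dirichlet_def by (simp add: sum_distrib_left mult.commute)
qed

lemma dirichlet_Cauchy_Schwarz: "(dirichlet F f g)\<^sup>2 \<le> dirichlet F f f * dirichlet F g g"
proof -
  have "(\<Sum>e\<in>edges_meeting F. (f (fst e) - f (snd e)) * (g (fst e) - g (snd e)))\<^sup>2
     \<le> (\<Sum>e\<in>edges_meeting F. (f (fst e) - f (snd e))\<^sup>2) * (\<Sum>e\<in>edges_meeting F. (g (fst e) - g (snd e))\<^sup>2)"
    by (rule Cauchy_Schwarz_ineq_sum)
  then show ?thesis
    unfolding dirichlet_def by (simp add: case_prod_beta power_divide power2_eq_square)
qed

lemma dirichlet_le_energy:
  assumes "finite F" shows "ennreal (dirichlet F h h) \<le> energy E h"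
proof -
  have "ennreal (\<Sum>(x, y)\<in>edges_meeting F. (h x - h y) * (h x - h y))
      = (\<integral>\<^sup>+(x, y). ennreal ((h x - h y)\<^sup>2) \<partial>count_space (edges_meeting F))"
    by (subst nn_integral_count_space_finite[OF finite_edges_meeting[OF assms]])
       (subst sum_ennreal[symmetric], auto simp: power2_eq_square intro!: sum.cong)
  also have "\<dots> \<le> (\<integral>\<^sup>+(x, y). ennreal ((h x - h y)\<^sup>2) \<partial>count_space {(x, y). {x, y} \<in> E})"
    by (subst (1 2) nn_integral_count_space_indicator)
       (auto simp: edges_meeting_def intro!: nn_integral_mono split: split_indicator)
  finally show ?thesis
    unfolding dirichlet_def energy_def
    by (subst divide_ennreal[symmetric]) (auto intro!: divide_right_mono_ennreal sum_nonneg)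
qed

lemma energy_finite_support:
  assumes F: "finite F" "\<And>x. x \<notin> F \<Longrightarrow> g x = 0"
  shows "energy E g = ennreal (dirichlet F g g)"
proof -
  have "(\<integral>\<^sup>+(x, y). ennreal ((g x - g y)\<^sup>2) \<partial>count_space {(x, y). {x, y} \<in> E})
     = (\<integral>\<^sup>+(x, y). ennreal ((g x - g y)\<^sup>2) \<partial>count_space (edges_meeting F))"
    by (subst (1 2) nn_integral_count_space_indicator)
       (auto simp: edges_meeting_def F(2) intro!: nn_integral_cong split: split_indicator)
  also have "\<dots> = ennreal (\<Sum>(x, y)\<in>edges_meeting F. (g x - g y) * (g x - g y))"
    by (subst nn_integral_count_space_finite[OF finite_edges_meeting[OF F(1)]])
       (subst sum_ennreal[symmetric], auto simp: power2_eq_square intro!: sum.cong)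
  finally show ?thesis
    unfolding dirichlet_def energy_def
    by (subst divide_ennreal[symmetric]) (auto intro!: sum_nonneg)
qed

lemma inverse_ennreal_antimono: "inverse b \<le> inverse a" if "a \<le> b" for a b :: ennreal
  using that
proof (cases a; cases b)
  fix r s :: real
  assume "a = ennreal r" "0 \<le> r" "b = ennreal s" "0 \<le> s"
  with that show ?thesis by (cases "r = 0") (auto simp: inverse_ennreal)
qed (auto simp: top_unique)

text \<open>
  Rescaling \<open>g\<close> to take the values \<open>1\<close> at \<open>x\<close> and \<open>0\<close> at \<open>y\<close> makes it a competitor in the variational
  definition of the resistance.
\<close>

lemma eff_resistance_bound:
  assumes F: "finite F" "\<And>x. x \<notin> F \<Longrightarrow> g x = 0"
    and L: "eff_resistance E {x} {y} \<le> ennreal L" "0 \<le> L"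
  shows "(g x - g y)\<^sup>2 \<le> L * dirichlet F g g"
proof (cases "g x = g y")
  case True
  then show ?thesis using L(2) dirichlet_nonneg[of F g] by simp
next
  case False
  define c where "c = (g x - g y)\<^sup>2"
  have c: "0 < c" using False by (simp add: c_def)
  define f where "f z = (g z - g y) / (g x - g y)" for z
  have "energy E f = (\<integral>\<^sup>+(x, y). ennreal (1 / c) * ennreal ((g x - g y)\<^sup>2) \<partial>count_space {(x, y). {x, y} \<in> E}) / 2"
    unfolding energy_def
  proof (intro arg_cong[where f="\<lambda>z. z / 2"] nn_integral_cong, clarsimp)
    fix a b
    have "f a - f b = (g a - g b) / (g x - g y)" by (simp add: f_def diff_divide_distrib)
    then have "(f a - f b)\<^sup>2 = 1 / c * (g a - g b)\<^sup>2" by (simp add: c_def power_divide)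
    then show "ennreal ((f a - f b)\<^sup>2) = ennreal (1 / c) * ennreal ((g a - g b)\<^sup>2)"
      using c by (simp add: ennreal_mult[symmetric])
  qed
  also have "\<dots> = ennreal (1 / c) * energy E g"
  proof -
    have "(\<integral>\<^sup>+(x, y). ennreal (1 / c) * ennreal ((g x - g y)\<^sup>2) \<partial>count_space {(x, y). {x, y} \<in> E})
      = ennreal (1 / c) * (\<integral>\<^sup>+(x, y). ennreal ((g x - g y)\<^sup>2) \<partial>count_space {(x, y). {x, y} \<in> E})"
      unfolding case_prod_beta by (rule nn_integral_cmult) simp
    then show ?thesis unfolding energy_def by (simp add: ennreal_times_divide)
  qed
  also have "\<dots> = ennreal (dirichlet F g g / c)"
  proof -
    have "energy E g = ennreal (dirichlet F g g)" by (rule energy_finite_support[OF F])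
    then show ?thesis using c dirichlet_nonneg[of F g] by (simp add: ennreal_mult[symmetric])
  qed
  finally have f: "energy E f = ennreal (dirichlet F g g / c)" .
  have "(INF f\<in>{f. energy E f < \<infinity> \<and> (\<forall>x\<in>{x}. f x = 1) \<and> (\<forall>x\<in>{y}. f x = 0)}. energy E f) \<le> energy E f"
    using False by (intro INF_lower) (auto simp: f, auto simp: f_def)
  then have "inverse (energy E f) \<le> eff_resistance E {x} {y}"
    unfolding eff_resistance_def by (rule inverse_ennreal_antimono)
  with L have *: "inverse (ennreal (dirichlet F g g / c)) \<le> ennreal L" by (simp add: f)
  have D: "0 < dirichlet F g g"
  proof (rule ccontr)
    assume "\<not> 0 < dirichlet F g g"
    then have "dirichlet F g g = 0" using dirichlet_nonneg[of F g] by simp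
    then show False using * by (simp add: top_unique)
  qed
  then have "c / dirichlet F g g \<le> L"
    using * c L(2) by (simp add: inverse_ennreal)
  then show ?thesis using D by (simp add: c_def field_simps)
qed

section \<open>The Green function up to a fixed time\<close>

definition green :: "'v set \<Rightarrow> nat \<Rightarrow> 'v \<Rightarrow> real" where
  "green B n y = (\<Sum>k<n. killed B k y)"

lemma green_nonneg: "0 \<le> green B n y"
  unfolding green_def by (intro sum_nonneg killed_nonneg)

lemma green_outside: "x\<^sub>0 \<in> B \<Longrightarrow> y \<notin> B \<inter> G \<Longrightarrow> green B n y = 0"
  unfolding green_def using killed_outside[of B y] killed_outside_graph[of y B] by auto

lemma finite_support_green: "finite {y. green B n y \<noteq> 0}"
proof (rule finite_subset)
  show "{y. green B n y \<noteq> 0} \<subseteq> (\<Union>k<n. {y. killed B k y \<noteq> 0})"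
    unfolding green_def by (auto elim: sum.not_neutral_contains_not_neutral)
qed (auto intro: finite_support_killed)

lemma sum_nbrs_killed: "y \<in> B \<Longrightarrow> (\<Sum>z\<in>nbrs E y. killed B n z) = degree E y * killed B (Suc n) y"
  using degree_eq[of y] by (cases "nbrs E y = {}") auto

text \<open>
  The Poisson equation for \<open>green B n\<close>: averaging over neighbours shifts the time in the sum
  by one, and the difference telescopes.
\<close>

lemma laplacian_green:
  assumes "x\<^sub>0 \<in> B" "y \<in> B \<inter> G"
  shows "(\<Sum>z\<in>nbrs E y. green B n y - green B n z) = indicator {x\<^sub>0} y - degree E y * killed B n y"
proof -
  have "(\<Sum>z\<in>nbrs E y. green B n z) = (\<Sum>k<n. \<Sum>z\<in>nbrs E y. killed B k z)"
    unfolding green_def by (rule sum.swap)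
  also have "\<dots> = degree E y * (\<Sum>k<n. killed B (Suc k) y)"
    using assms by (simp add: sum_nbrs_killed sum_distrib_left del: killed.simps)
  finally have "(\<Sum>z\<in>nbrs E y. green B n y - green B n z)
      = degree E y * ((\<Sum>k<n. killed B k y) - (\<Sum>k<n. killed B (Suc k) y))"
    by (simp add: sum_subtractf degree_eq green_def right_diff_distrib del: killed.simps)
  also have "(\<Sum>k<n. killed B k y) - (\<Sum>k<n. killed B (Suc k) y) = killed B 0 y - killed B n y"
    using sum_lessThan_telescope'[of "\<lambda>k. killed B k y" n] by (simp add: sum_subtractf del: killed.simps)
  finally show ?thesis
    using degree_ge_1[of y] assms by (simp add: right_diff_distrib)
qed

text \<open>
  Pair the Poisson equation with \<open>green B n\<close> itself; the term with \<open>killed B n\<close> has a favourable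
  sign.
\<close>

lemma dirichlet_green_le:
  assumes B: "x\<^sub>0 \<in> B" and F: "finite F" "\<And>y. y \<notin> F \<Longrightarrow> green B n y = 0"
  shows "dirichlet F (green B n) (green B n) \<le> green B n x\<^sub>0"
proof -
  have "dirichlet F (green B n) (green B n)
      = (\<Sum>x\<in>F. green B n x * (\<Sum>y\<in>nbrs E x. green B n x - green B n y))"
    by (rule Green_formula[OF F])
  also have "\<dots> \<le> (\<Sum>x\<in>F. green B n x * indicator {x\<^sub>0} x)"
  proof (rule sum_mono)
    fix x
    show "green B n x * (\<Sum>y\<in>nbrs E x. green B n x - green B n y) \<le> green B n x * indicator {x\<^sub>0} x"
    proof (cases "x \<in> B \<inter> G")
      case True
      then show ?thesis unfolding laplacian_green[OF B True]
        using killed_nonneg[of B n x] by (intro mult_left_mono green_nonneg) auto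
    qed (simp add: green_outside[OF B])
  qed
  also have "\<dots> \<le> green B n x\<^sub>0"
    using F(1) by (cases "x\<^sub>0 \<in> F") (auto simp: indicator_def sum.If_cases green_nonneg
      Int_insert_right intro!: sum_nonneg)
  finally show ?thesis .
qed

lemma green_diff_le:
  assumes B: "x\<^sub>0 \<in> B" and L: "eff_resistance E {x\<^sub>0} {y} \<le> ennreal L" "0 \<le> L"
  shows "(green B n x\<^sub>0 - green B n y)\<^sup>2 \<le> L * green B n x\<^sub>0"
proof -
  let ?F = "{y. green B n y \<noteq> 0}"
  have "(green B n x\<^sub>0 - green B n y)\<^sup>2 \<le> L * dirichlet ?F (green B n) (green B n)"
    by (rule eff_resistance_bound[OF finite_support_green _ L]) simp
  also have "\<dots> \<le> L * green B n x\<^sub>0"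
    by (intro mult_left_mono L dirichlet_green_le B finite_support_green) simp
  finally show ?thesis .
qed


definition vol :: "'v set \<Rightarrow> real" where
  "vol A = (\<Sum>x\<in>A. real (degree E x))"

text \<open>
  The tail \<open>P(\<tau> > n)\<close> of the exit time \<open>\<tau>\<close> from \<open>B\<close>.
\<close>

definition stay :: "'v set \<Rightarrow> nat \<Rightarrow> real" where
  "stay B n = measure (srw_law E x\<^sub>0) {w. \<forall>i\<le>n. w i \<in> B}"

lemma stay_eq_sum:
  assumes "x\<^sub>0 \<in> B" "finite F" "\<And>y. y \<notin> F \<Longrightarrow> killed B n y = 0"
  shows "stay B n = (\<Sum>y\<in>F. degree E y * killed B n y)"
  using emeasure_killed_sum[of B F n] assms unfolding stay_def measure_def
  by (simp add: sum_nonneg killed_nonneg)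

lemma stay_le_1: "stay B n \<le> 1"
  unfolding stay_def using prob_space.prob_le_1[OF prob_space_srw_law] .

lemma stay_nonneg: "0 \<le> stay B n"
  unfolding stay_def by simp

lemma sum_killed_le_stay:
  assumes "x\<^sub>0 \<in> B" "finite A"
  shows "(\<Sum>y\<in>A. degree E y * killed B n y) \<le> stay B n"
proof -
  have "(\<Sum>y\<in>A. degree E y * killed B n y)
     \<le> (\<Sum>y\<in>A \<union> {y. killed B n y \<noteq> 0}. degree E y * killed B n y)"
    using assms(2) by (intro sum_mono2) (auto simp: finite_support_killed killed_nonneg)
  also have "\<dots> = stay B n"
    using assms by (intro stay_eq_sum[symmetric]) (auto simp: finite_support_killed)
  finally show ?thesis .
qed

lemma sum_green_le:
  assumes "x\<^sub>0 \<in> B" "finite A"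
  shows "(\<Sum>y\<in>A. degree E y * green B n y) \<le> (\<Sum>k<n. stay B k)"
proof -
  have "(\<Sum>y\<in>A. degree E y * green B n y) = (\<Sum>k<n. \<Sum>y\<in>A. degree E y * killed B k y)"
    unfolding green_def by (simp add: sum_distrib_left) (rule sum.swap)
  also have "\<dots> \<le> (\<Sum>k<n. stay B k)" by (intro sum_mono sum_killed_le_stay assms)
  finally show ?thesis .
qed

text \<open>
  The inequality between the geometric and the arithmetic mean linearises \<open>green_diff_le\<close>; the term
  with \<open>green B n x\<^sub>0\<close> can then be absorbed on the left.
\<close>

lemma green_abs_diff_le:
  assumes "x\<^sub>0 \<in> B" and L: "eff_resistance E {x\<^sub>0} {y} \<le> ennreal L" "0 \<le> L"
  shows "\<bar>green B n x\<^sub>0 - green B n y\<bar> \<le> (L + green B n x\<^sub>0) / 2"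
proof -
  let ?a = "green B n x\<^sub>0" and ?b = "green B n y"
  have "(?a - ?b)\<^sup>2 \<le> L * ?a" by (rule green_diff_le[OF assms])
  also have "\<dots> \<le> ((L + ?a) / 2)\<^sup>2"
  proof -
    have "(L + ?a)\<^sup>2 = (L - ?a)\<^sup>2 + 4 * (L * ?a)"
      by (simp add: power2_eq_square algebra_simps)
    then show ?thesis by (simp add: power_divide)
  qed
  finally have "\<bar>?a - ?b\<bar> \<le> \<bar>(L + ?a) / 2\<bar>" unfolding abs_le_square_iff .
  then show ?thesis using L(2) green_nonneg[of B n x\<^sub>0] by simp
qed

lemma green_root_le:
  assumes "x\<^sub>0 \<in> B" and L: "eff_resistance E {x\<^sub>0} {y} \<le> ennreal L" "0 \<le> L"
  shows "green B n x\<^sub>0 \<le> 2 * green B n y + L"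
  using green_abs_diff_le[OF assms, of n, THEN abs_le_D1] green_nonneg[of B n x\<^sub>0] L(2) by simp

lemma green_le_root:
  assumes "x\<^sub>0 \<in> B" and L: "eff_resistance E {x\<^sub>0} {y} \<le> ennreal L" "0 \<le> L"
  shows "green B n y \<le> (3 * green B n x\<^sub>0 + L) / 2"
  using green_abs_diff_le[OF assms, of n, THEN abs_le_D2] green_nonneg[of B n x\<^sub>0] L(2) by simp

text \<open>
  The mass of \<open>green B n\<close> on \<open>A\<close> is at most \<open>n\<close>, so its average over \<open>A\<close> is at most \<open>n / vol A\<close>, and
  by the resistance bound its value at the root is comparable to this average.
\<close>

lemma green_root_le_volume:
  assumes B: "x\<^sub>0 \<in> B" and A: "finite A" "0 < vol A"
    and L: "\<And>y. y \<in> A \<Longrightarrow> eff_resistance E {x\<^sub>0} {y} \<le> ennreal L" "0 \<le> L"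
  shows "green B n x\<^sub>0 \<le> 2 * real n / vol A + L"
proof -
  let ?a = "green B n x\<^sub>0"
  have "(?a - L) * vol A = (\<Sum>y\<in>A. degree E y * (?a - L))"
    unfolding vol_def by (simp add: sum_distrib_right mult.commute)
  also have "\<dots> \<le> (\<Sum>y\<in>A. degree E y * (2 * green B n y))"
    using green_root_le[OF B L(1) L(2)] by (intro sum_mono mult_left_mono) (auto simp: algebra_simps)
  also have "\<dots> = 2 * (\<Sum>y\<in>A. degree E y * green B n y)"
    by (simp add: sum_distrib_left mult_ac)
  also have "\<dots> \<le> 2 * (\<Sum>k<n. stay B k)"
    by (intro mult_left_mono sum_green_le B A) simp
  also have "(\<Sum>k<n. stay B k) \<le> (\<Sum>k<n. 1)" by (intro sum_mono stay_le_1)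
  finally have "(?a - L) * vol A \<le> 2 * n" by simp
  then show ?thesis using A(2) by (simp add: field_simps)
qed

text \<open>
  For \<open>h\<close> with \<open>h = 1\<close> at the root, \<open>h = 0\<close> off \<open>B\<close> and \<open>h \<le> 1\<close>, the Poisson equation
  gives \<open>\<E>(h, green B n) = 1 - \<Sum>x. h(x) P(\<tau> > n, X\<^sub>n = x) \<ge> P(\<tau> \<le> n)\<close>. Cauchy-Schwarz with \<open>\<E>(h, h)\<close>
  close to the infimum \<open>1 / R\<^sub>e\<^sub>f\<^sub>f\<close> finishes the proof.
\<close>

lemma exit_probability_le:
  assumes B: "x\<^sub>0 \<in> B" "finite (B \<inter> G)"
    and res: "ennreal \<kappa> \<le> eff_resistance E {x\<^sub>0} (G - B)" "0 < \<kappa>"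
  shows "(1 - stay B n)\<^sup>2 \<le> green B n x\<^sub>0 / \<kappa>"
proof -
  let ?g = "green B n" and ?F = "B \<inter> G"
  have *: "(1 - stay B n)\<^sup>2 \<le> ?g x\<^sub>0 * t" if t: "1 / \<kappa> < t" for t
  proof -
    let ?S = "{f. energy E f < \<infinity> \<and> (\<forall>x\<in>{x\<^sub>0}. f x = 1) \<and> (\<forall>x\<in>G - B. f x = 0)}"
    have "0 < t" using t res(2) by (smt (verit) divide_pos_pos)
    have "(INF f\<in>?S. energy E f) < ennreal t"
    proof (rule ccontr)
      assume "\<not> (INF f\<in>?S. energy E f) < ennreal t"
      then have "ennreal t \<le> (INF f\<in>?S. energy E f)" by simp
      then have "eff_resistance E {x\<^sub>0} (G - B) \<le> inverse (ennreal t)"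
        unfolding eff_resistance_def by (rule inverse_ennreal_antimono)
      also have "inverse (ennreal t) = ennreal (1 / t)"
        using \<open>0 < t\<close> by (simp add: inverse_ennreal inverse_eq_divide)
      finally have "ennreal \<kappa> \<le> ennreal (1 / t)" by (rule order_trans[OF res(1)])
      then have "\<kappa> \<le> 1 / t" using \<open>0 < t\<close> by (simp add: ennreal_le_iff)
      then show False using t \<open>0 < t\<close> res(2) by (simp add: field_simps)
    qed
    then obtain h where h: "h x\<^sub>0 = 1" "\<And>x. x \<in> G - B \<Longrightarrow> h x = 0" "energy E h < ennreal t"
      by (auto simp: INF_less_iff)
    \<comment> \<open>Truncation at \<open>1\<close> does not increase the energy; setting \<open>h'\<close> to \<open>0\<close> off the graph, which no edge sees, makes its support finite.\<close>
    define h' where "h' x = (if x \<in> ?F then min 1 (h x) else 0)" for x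
    have h'_edge: "h' x = min 1 (h x)" if "x \<in> G" for x
      using h(2)[of x] that by (auto simp: h'_def)
    have "energy E h' \<le> energy E h"
      unfolding energy_def
    proof (intro divide_right_mono_ennreal nn_integral_mono)
      fix e assume "e \<in> space (count_space {(x, y). {x, y} \<in> E})"
      then obtain a b where e: "e = (a, b)" and "{a, b} \<in> E" by auto
      then have "a \<in> G" "b \<in> G" using edgeD by auto
      then have "\<bar>h' a - h' b\<bar> \<le> \<bar>h a - h b\<bar>" by (auto simp: h'_edge min_def)
      then show "(case e of (x, y) \<Rightarrow> ennreal ((h' x - h' y)\<^sup>2)) \<le> (case e of (x, y) \<Rightarrow> ennreal ((h x - h y)\<^sup>2))"
        unfolding e prod.case abs_le_square_iff by (rule ennreal_leI)
    qed
    then have "ennreal (dirichlet ?F h' h') \<le> ennreal t"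
      using dirichlet_le_energy[OF B(2), of h'] h(3) by (meson order.trans order.strict_implies_order)
    then have Dt: "dirichlet ?F h' h' \<le> t" using \<open>0 < t\<close> by (simp add: ennreal_le_iff)
    have "1 - stay B n \<le> (\<Sum>x\<in>?F. h' x * (\<Sum>y\<in>nbrs E x. ?g x - ?g y))"
    proof -
      have "(\<Sum>x\<in>?F. h' x * (\<Sum>y\<in>nbrs E x. ?g x - ?g y))
          = (\<Sum>x\<in>?F. h' x * indicator {x\<^sub>0} x) - (\<Sum>x\<in>?F. h' x * (degree E x * killed B n x))"
        unfolding sum_subtractf[symmetric] right_diff_distrib[symmetric]
        by (intro sum.cong refl) (simp add: laplacian_green[OF B(1)])
      moreover have "(\<Sum>x\<in>?F. h' x * indicator {x\<^sub>0} x) = 1"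
        using B root h(1) h'_edge[OF root] by (simp add: indicator_def sum.If_cases)
      moreover have "(\<Sum>x\<in>?F. h' x * (degree E x * killed B n x)) \<le> (\<Sum>x\<in>?F. 1 * (degree E x * killed B n x))"
        by (intro sum_mono mult_right_mono) (auto simp: h'_def killed_nonneg)
      moreover have "(\<Sum>x\<in>?F. degree E x * killed B n x) = stay B n"
        using B by (intro stay_eq_sum[symmetric]) (auto simp: killed_outside killed_outside_graph)
      ultimately show ?thesis by simp
    qed
    also have "\<dots> = dirichlet ?F ?g h'"
      by (rule Green_formula[symmetric, OF B(2)]) (auto simp: h'_def)
    finally have "(1 - stay B n)\<^sup>2 \<le> (dirichlet ?F ?g h')\<^sup>2"
      using stay_le_1[of B n] by (intro power_mono) auto
    also have "\<dots> \<le> dirichlet ?F ?g ?g * dirichlet ?F h' h'" by (rule dirichlet_Cauchy_Schwarz)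
    also have "\<dots> \<le> ?g x\<^sub>0 * t"
      using dirichlet_green_le[OF B(1) B(2), of n] green_outside[OF B(1)] Dt
      by (intro mult_mono) (auto simp: green_nonneg dirichlet_nonneg)
    finally show ?thesis .
  qed
  show ?thesis
  proof (cases "?g x\<^sub>0 = 0")
    case True
    then show ?thesis using *[of "1 / \<kappa> + 1"] by simp
  next
    case False
    then have g: "0 < ?g x\<^sub>0" using green_nonneg[of B n x\<^sub>0] by simp
    have "(1 - stay B n)\<^sup>2 / ?g x\<^sub>0 \<le> 1 / \<kappa>"
    proof (rule dense_ge)
      fix t assume "1 / \<kappa> < t"
      from *[OF this] show "(1 - stay B n)\<^sup>2 / ?g x\<^sub>0 \<le> t"
        using g by (simp add: pos_divide_le_eq mult.commute)
    qed
    then show ?thesis using g by (simp add: pos_divide_le_eq mult.commute)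
  qed
qed

end

section \<open>On-diagonal heat kernel\<close>

context rooted_graph
begin

lemma sum_over_nbrs:
  fixes f :: "'v \<Rightarrow> real"
  assumes F: "finite F" "\<And>y. y \<notin> F \<Longrightarrow> f y = 0"
  shows "(\<Sum>y\<in>nbrs E x. f y) = (\<Sum>y\<in>F. indicator (nbrs E x) y * f y)"
proof -
  have "(\<Sum>y\<in>nbrs E x. f y) = (\<Sum>y\<in>nbrs E x \<inter> F. f y)"
    using F(2) by (intro sum.mono_neutral_right) auto
  also have "\<dots> = (\<Sum>y\<in>F. indicator (nbrs E x) y * f y)"
    unfolding Int_commute[of "nbrs E x"] sum.inter_restrict[OF F(1)]
    by (intro sum.cong) (auto simp: indicator_def)
  finally show ?thesis .
qed

text \<open>
  Symmetry of the one-step operator moves one step at a time from the left factor to the right one,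
  until the left factor is the normalised indicator of the root.
\<close>

lemma heat_inner_product:
  assumes F: "finite F" "\<And>k y. k \<le> n + m \<Longrightarrow> y \<notin> F \<Longrightarrow> killed UNIV k y = 0"
  shows "(\<Sum>x\<in>F. degree E x * (killed UNIV n x * killed UNIV m x)) = killed UNIV (n + m) x\<^sub>0"
  using F(2)
proof (induction n arbitrary: m)
  case 0
  have "x\<^sub>0 \<in> F" using 0[of 0 x\<^sub>0] degree_ge_1[OF root] by auto
  then show ?case
    using F(1) degree_ge_1[OF root] by (simp add: indicator_def sum.If_cases)
next
  case (Suc n)
  let ?k = "killed UNIV"
  have step: "degree E x * ?k (Suc i) x = (\<Sum>y\<in>F. indicator (nbrs E x) y * ?k i y)"
    if "i \<le> Suc (n + m)" for i x
    using that Suc.prems F(1) by (subst sum_nbrs_killed[symmetric]) (simp, rule sum_over_nbrs, auto)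
  have "(\<Sum>x\<in>F. degree E x * (?k (Suc n) x * ?k m x))
      = (\<Sum>x\<in>F. \<Sum>y\<in>F. indicator (nbrs E x) y * (?k n y * ?k m x))"
    unfolding mult.assoc[symmetric] by (simp add: step sum_distrib_left sum_distrib_right mult_ac del: killed.simps)
  also have "\<dots> = (\<Sum>y\<in>F. \<Sum>x\<in>F. indicator (nbrs E y) x * (?k n y * ?k m x))"
    by (subst sum.swap) (simp add: indicator_def nbrs_sym)
  also have "\<dots> = (\<Sum>y\<in>F. ?k n y * (degree E y * ?k (Suc m) y))"
    by (simp add: step sum_distrib_left mult_ac del: killed.simps)
  also have "\<dots> = (\<Sum>y\<in>F. degree E y * (?k n y * ?k (Suc m) y))"
    by (simp add: mult_ac del: killed.simps)
  also have "\<dots> = ?k (n + Suc m) x\<^sub>0"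
    using Suc.prems by (intro Suc.IH) auto
  finally show ?case by simp
qed

lemma finite_support_heat: "finite (\<Union>k\<le>n. {y. killed B k y \<noteq> 0})"
  by (auto intro: finite_support_killed)

lemma heat_even_eq_sum:
  assumes F: "finite F" "\<And>k y. k \<le> 2 * n \<Longrightarrow> y \<notin> F \<Longrightarrow> killed UNIV k y = 0"
  shows "(\<Sum>x\<in>F. degree E x * (killed UNIV n x)\<^sup>2) = killed UNIV (2 * n) x\<^sub>0"
  using heat_inner_product[of F n n] F by (simp add: power2_eq_square mult_2)

text \<open>
  The even return densities are squared \<open>\<ell>\<^sup>2(\<mu>)\<close>-norms by \<open>heat_even_eq_sum\<close>, and averaging over
  neighbours is a contraction of \<open>\<ell>\<^sup>2(\<mu>)\<close>.
\<close>

lemma heat_even_decreasing: "killed UNIV (2 * Suc n) x\<^sub>0 \<le> killed UNIV (2 * n) x\<^sub>0"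
proof -
  let ?k = "killed UNIV"
  define F where "F = (\<Union>k\<le>2 * Suc n. {y. ?k k y \<noteq> 0})"
  have F: "finite F" "\<And>k y. k \<le> 2 * Suc n \<Longrightarrow> y \<notin> F \<Longrightarrow> ?k k y = 0"
    unfolding F_def using finite_support_heat[where B=UNIV] by auto
  have "?k (2 * Suc n) x\<^sub>0 = (\<Sum>x\<in>F. degree E x * (?k (Suc n) x)\<^sup>2)"
    using F by (intro heat_even_eq_sum[symmetric]) auto
  also have "\<dots> \<le> (\<Sum>x\<in>F. \<Sum>y\<in>nbrs E x. (?k n y)\<^sup>2)"
  proof (rule sum_mono)
    fix x
    have "(\<Sum>y\<in>nbrs E x. 1 * ?k n y)\<^sup>2 \<le> (\<Sum>y\<in>nbrs E x. 1\<^sup>2) * (\<Sum>y\<in>nbrs E x. (?k n y)\<^sup>2)"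
      by (rule Cauchy_Schwarz_ineq_sum)
    then have *: "(degree E x * ?k (Suc n) x)\<^sup>2 \<le> degree E x * (\<Sum>y\<in>nbrs E x. (?k n y)\<^sup>2)"
      by (simp add: sum_nbrs_killed degree_eq[symmetric] del: killed.simps)
    show "degree E x * (?k (Suc n) x)\<^sup>2 \<le> (\<Sum>y\<in>nbrs E x. (?k n y)\<^sup>2)"
    proof (cases "degree E x = 0")
      case False
      then have "degree E x * (degree E x * (?k (Suc n) x)\<^sup>2) \<le> degree E x * (\<Sum>y\<in>nbrs E x. (?k n y)\<^sup>2)"
        using * by (simp add: power2_eq_square mult_ac del: killed.simps)
      then show ?thesis using False by (simp del: killed.simps)
    qed (simp add: sum_nonneg)
  qed
  also have "\<dots> = (\<Sum>x\<in>F. \<Sum>y\<in>F. indicator (nbrs E x) y * (?k n y)\<^sup>2)"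
    using F by (intro sum.cong refl sum_over_nbrs) auto
  also have "\<dots> = (\<Sum>y\<in>F. (\<Sum>x\<in>F. indicator (nbrs E y) x) * (?k n y)\<^sup>2)"
    by (subst sum.swap) (simp add: sum_distrib_right indicator_def nbrs_sym)
  also have "\<dots> \<le> (\<Sum>y\<in>F. degree E y * (?k n y)\<^sup>2)"
  proof (intro sum_mono mult_right_mono)
    fix y
    show "(\<Sum>x\<in>F. indicator (nbrs E y) x) \<le> real (degree E y)"
      using F(1) card_mono[of "nbrs E y" "F \<inter> nbrs E y"] sum.inter_restrict[OF F(1), of "\<lambda>_. 1 :: real" "nbrs E y"]
      by (simp add: indicator_def of_bool_def degree_eq)
  qed simp
  also have "\<dots> = ?k (2 * n) x\<^sub>0"
    using F by (intro heat_even_eq_sum) auto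
  finally show ?thesis .
qed

text \<open>
  By monotonicity \<open>n\<close> copies of \<open>p\<^bsub>2n\<^esub>\<close> are dominated by the even terms of the Green function.
\<close>

lemma heat_even_le_green: "n * killed UNIV (2 * n) x\<^sub>0 \<le> green UNIV (2 * n + 1) x\<^sub>0"
proof -
  let ?k = "killed UNIV"
  have dec: "?k (2 * n) x\<^sub>0 \<le> ?k (2 * i) x\<^sub>0" if "i \<le> n" for i
    by (rule lift_Suc_antimono_le[of "\<lambda>i. ?k (2 * i) x\<^sub>0", OF _ that]) (rule heat_even_decreasing)
  have "n * ?k (2 * n) x\<^sub>0 = (\<Sum>i<n. ?k (2 * n) x\<^sub>0)" by simp
  also have "\<dots> \<le> (\<Sum>i<n. ?k (2 * i) x\<^sub>0)" by (intro sum_mono dec) auto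
  also have "\<dots> = (\<Sum>j\<in>(\<lambda>i. 2 * i) ` {..<n}. ?k j x\<^sub>0)"
    by (subst sum.reindex) (auto simp: inj_on_def)
  also have "\<dots> \<le> green UNIV (2 * n + 1) x\<^sub>0"
    unfolding green_def by (intro sum_mono2) (auto simp: killed_nonneg)
  finally show ?thesis .
qed

lemma emeasure_walk_at: "emeasure (srw_law E x\<^sub>0) {w. w n = y} = ennreal (degree E y * killed UNIV n y)"
  using emeasure_killed[of UNIV n y] by simp

lemma heat_kernel_eq: "y \<in> G \<Longrightarrow> heat_kernel E n x\<^sub>0 y = killed UNIV n y"
  unfolding heat_kernel_def measure_def using emeasure_walk_at[of n y] degree_ge_1[of y]
  by (simp add: killed_nonneg)

lemma measure_walk_in:
  assumes "finite A"
  shows "measure (srw_law E x\<^sub>0) {w. w n \<in> A} = (\<Sum>y\<in>A. degree E y * killed UNIV n y)"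
proof -
  interpret prob_space "srw_law E x\<^sub>0" by (rule prob_space_srw_law)
  have [measurable]: "{w. w n = y} \<in> sets path_space" for y :: 'v
    by (rule sets_walk_at)
  have "{w. w n \<in> A} = (\<Union>y\<in>A. {w. w n = y})" by auto
  then have "measure (srw_law E x\<^sub>0) {w. w n \<in> A} = (\<Sum>y\<in>A. measure (srw_law E x\<^sub>0) {w. w n = y})"
    using assms by (simp only:) (intro finite_measure_finite_Union, auto simp: disjoint_family_on_def)
  also have "\<dots> = (\<Sum>y\<in>A. degree E y * killed UNIV n y)"
    by (simp add: measure_def emeasure_walk_at killed_nonneg)
  finally show ?thesis .
qed

text \<open>
  Cauchy-Schwarz in \<open>\<ell>\<^sup>2(\<mu>)\<close> between \<open>1\<^sub>A\<close> and the density at time \<open>n\<close>, whose squared norm is the return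
  density at time \<open>2n\<close>.
\<close>

lemma walk_in_le:
  assumes A: "finite A"
  shows "(measure (srw_law E x\<^sub>0) {w. w n \<in> A})\<^sup>2 \<le> vol A * killed UNIV (2 * n) x\<^sub>0"
proof -
  let ?k = "killed UNIV"
  define F where "F = A \<union> (\<Union>k\<le>2 * n. {y. ?k k y \<noteq> 0})"
  have F: "finite F" "\<And>k y. k \<le> 2 * n \<Longrightarrow> y \<notin> F \<Longrightarrow> ?k k y = 0"
    unfolding F_def using finite_support_heat[where B=UNIV] A by auto
  have "(\<Sum>y\<in>A. sqrt (degree E y) * (sqrt (degree E y) * ?k n y))\<^sup>2
     \<le> (\<Sum>y\<in>A. (sqrt (degree E y))\<^sup>2) * (\<Sum>y\<in>A. (sqrt (degree E y) * ?k n y)\<^sup>2)"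
    by (rule Cauchy_Schwarz_ineq_sum)
  then have "(measure (srw_law E x\<^sub>0) {w. w n \<in> A})\<^sup>2 \<le> vol A * (\<Sum>y\<in>A. degree E y * (?k n y)\<^sup>2)"
    unfolding measure_walk_in[OF A] vol_def by (simp add: mult.assoc[symmetric] power_mult_distrib)
  also have "(\<Sum>y\<in>A. degree E y * (?k n y)\<^sup>2) \<le> (\<Sum>y\<in>F. degree E y * (?k n y)\<^sup>2)"
    using F(1) by (intro sum_mono2) (auto simp: F_def)
  also have "\<dots> = ?k (2 * n) x\<^sub>0"
    using F by (intro heat_even_eq_sum) auto
  finally show ?thesis by (simp add: mult_left_mono vol_def sum_nonneg)
qed

lemma stay_le_walk_in: "stay B n \<le> measure (srw_law E x\<^sub>0) {w. w n \<in> B}"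
proof -
  interpret prob_space "srw_law E x\<^sub>0" by (rule prob_space_srw_law)
  have "{w. w n \<in> B} \<in> sets path_space" by (rule sets_walk_at)
  then show ?thesis unfolding stay_def by (intro finite_measure_mono) auto
qed

end

section \<open>Exit times and volumes\<close>

text \<open>
  The layer-cake formula \<open>\<tau> = \<Sum>k. 1{\<tau> > k}\<close>, valid also when \<open>\<tau> = \<infinity>\<close>.
\<close>

lemma exit_time_eq_suminf: "exit_time B w = (\<Sum>k. indicator {w. \<forall>i\<le>k. w i \<in> B} w)"
proof (cases "\<exists>n. w n \<notin> B")
  case True
  define N where "N = (LEAST n. w n \<notin> B)"
  have N: "w N \<notin> B" unfolding N_def using True by (rule LeastI_ex)
  have below: "w i \<in> B" if "i < N" for i using not_less_Least[of i "\<lambda>n. w n \<notin> B"] that by (auto simp: N_def)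
  have "exit_time B w = of_nat N"
    unfolding exit_time_def
  proof (rule antisym)
    show "(INF n\<in>{n. w n \<notin> B}. of_nat n :: ennreal) \<le> of_nat N" using N by (intro INF_lower) simp
    show "of_nat N \<le> (INF n\<in>{n. w n \<notin> B}. of_nat n :: ennreal)"
      unfolding N_def by (intro INF_greatest) (simp add: Least_le)
  qed
  moreover have "(\<Sum>k. indicator {w. \<forall>i\<le>k. w i \<in> B} w) = (\<Sum>k<N. indicator {w. \<forall>i\<le>k. w i \<in> B} w :: ennreal)"
    using N by (intro suminf_finite) (auto simp: indicator_def not_less)
  moreover have "\<dots> = (\<Sum>k<N. 1)"
    using below by (intro sum.cong) (auto simp: indicator_def)
  ultimately show ?thesis by simp
next
  case False
  then have "{n. w n \<notin> B} = {}" "\<And>k. indicator {w. \<forall>i\<le>k. w i \<in> B} w = (1::ennreal)" by auto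
  moreover have "(\<Sum>k. 1 :: ennreal) = top"
    using nn_integral_count_space_nat[of "\<lambda>_. 1"] by (simp add: emeasure_count_space)
  ultimately show ?thesis unfolding exit_time_def by simp
qed

lemma sets_stay: "{w. \<forall>i\<le>k. w i \<in> B} \<in> sets (path_space :: (nat \<Rightarrow> 'v::countable) measure)"
proof -
  have "{w. w i \<in> B} \<in> sets path_space" for i by (rule sets_walk_at)
  moreover have "{w. \<forall>i\<le>k. w i \<in> B} = (\<Inter>i\<le>k. {w. w i \<in> B})" by auto
  ultimately show ?thesis by (auto intro: sets.finite_INT)
qed

context rooted_graph
begin

lemma stay_decreasing: "m \<le> n \<Longrightarrow> stay B n \<le> stay B m"
  unfolding stay_def
  by (intro finite_measure.finite_measure_mono prob_space.finite_measure prob_space_srw_law)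
    (auto simp: sets_stay)

lemma expected_exit_time_eq: "(\<integral>\<^sup>+w. exit_time B w \<partial>srw_law E x\<^sub>0) = (\<Sum>k. ennreal (stay B k))"
proof -
  interpret prob_space "srw_law E x\<^sub>0" by (rule prob_space_srw_law)
  show ?thesis
    unfolding exit_time_eq_suminf stay_def using sets_stay[of _ B]
    by (subst nn_integral_suminf) (auto simp: emeasure_eq_measure)
qed

lemma expected_exit_time_le:
  assumes "\<And>n. (\<Sum>k<n. stay B k) \<le> c"
  shows "(\<integral>\<^sup>+w. exit_time B w \<partial>srw_law E x\<^sub>0) \<le> ennreal c"
  unfolding expected_exit_time_eq
  by (rule suminf_le_const) (auto simp: stay_nonneg sum_ennreal assms intro!: ennreal_leI)

lemma expected_exit_time_ge: "ennreal (n * stay B n) \<le> (\<integral>\<^sup>+w. exit_time B w \<partial>srw_law E x\<^sub>0)"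
proof -
  have "n * stay B n = (\<Sum>k<n. stay B n)" by simp
  also have "\<dots> \<le> (\<Sum>k<n. stay B k)" by (intro sum_mono stay_decreasing) auto
  finally have "ennreal (n * stay B n) \<le> (\<Sum>k<n. ennreal (stay B k))"
    by (simp add: sum_ennreal stay_nonneg ennreal_leI)
  also have "\<dots> \<le> (\<Sum>k. ennreal (stay B k))" by (rule sum_le_suminf) auto
  finally show ?thesis unfolding expected_exit_time_eq .
qed

text \<open>
  Every vertex has degree at least one, so a set of finite volume is finite.
\<close>

lemma volume_leD:
  assumes "A \<subseteq> G" and le: "emeasure (vertex_measure G E) A \<le> ennreal c"
  shows "finite A" "emeasure (vertex_measure G E) A = ennreal (vol A)"
proof -
  have *: "emeasure (vertex_measure G E) A = (\<integral>\<^sup>+x. of_nat (degree E x) * indicator A x \<partial>count_space G)"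
    unfolding vertex_measure_def point_measure_def using assms(1) by (simp add: emeasure_density)
  show "finite A"
  proof (rule ccontr)
    assume "infinite A"
    then have "\<infinity> = (\<integral>\<^sup>+x. indicator A x \<partial>count_space G)"
      using assms(1) by (simp add: emeasure_count_space)
    also have "\<dots> \<le> (\<integral>\<^sup>+x. of_nat (degree E x) * indicator A x \<partial>count_space G)"
      using degree_ge_1 by (intro nn_integral_mono) (auto simp: indicator_def)
    finally show False using le unfolding * by (simp add: top_unique)
  qed
  then show "emeasure (vertex_measure G E) A = ennreal (vol A)"
    unfolding vertex_measure_def vol_def using assms(1)
    by (subst emeasure_point_measure_finite2) (auto simp: ennreal_of_nat_eq_real_of_nat)
qed

end

section \<open>Measurable dependence on the environment and the annealed law\<close>

text \<open>
  Paths with a prescribed initial segment. There are countably many of them, together with the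
  empty set they form a generator of the path space that is stable under intersections, and their
  probabilities are explicit products, so they suffice to see that the law of the walk depends measurably on the graph.
\<close>

definition cylinder :: "'v list \<Rightarrow> (nat \<Rightarrow> 'v) set" where
  "cylinder xs = {w. \<forall>i<length xs. w i = xs ! i}"

lemma Int_cylinder_subset:
  assumes "length xs \<le> length ys"
  shows "cylinder xs \<inter> cylinder ys = cylinder ys \<or> cylinder xs \<inter> cylinder ys = {}"
proof (cases "\<forall>i<length xs. xs ! i = ys ! i")
  case True
  then show ?thesis using assms by (auto simp: cylinder_def)
next
  case False
  then obtain i where "i < length xs" "xs ! i \<noteq> ys ! i" by auto
  then show ?thesis using assms by (auto simp: cylinder_def)
qed

lemma Int_stable_cylinders: "Int_stable (insert {} (range cylinder))"
proof (rule Int_stableI)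
  fix A B :: "(nat \<Rightarrow> 'a) set"
  assume "A \<in> insert {} (range cylinder)" "B \<in> insert {} (range cylinder)"
  then consider "A = {} \<or> B = {}" | xs ys where "A = cylinder xs" "B = cylinder ys" by auto
  then show "A \<inter> B \<in> insert {} (range cylinder)"
  proof cases
    case (2 xs ys)
    then show ?thesis
      using Int_cylinder_subset[of xs ys] Int_cylinder_subset[of ys xs]
      by (cases "length xs \<le> length ys") (auto simp: Int_commute)
  qed auto
qed

lemma sets_path_space_cylinders:
  "sets (path_space :: (nat \<Rightarrow> 'v::countable) measure) = sigma_sets UNIV (insert {} (range cylinder))"
    (is "_ = ?S")
proof (rule antisym)
  interpret S: sigma_algebra UNIV ?S by (rule sigma_algebra_sigma_sets) auto
  have single: "{w::nat \<Rightarrow> 'v. w i \<in> A} \<in> ?S" for i A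
  proof -
    let ?L = "{xs :: 'v list. length xs = Suc i \<and> xs ! i \<in> A}"
    have "{w. w i \<in> A} = (\<Union>xs\<in>?L. cylinder xs)"
    proof (intro set_eqI iffI)
      fix w :: "nat \<Rightarrow> 'v" assume "w \<in> {w. w i \<in> A}"
      then show "w \<in> (\<Union>xs\<in>?L. cylinder xs)"
        by (intro UN_I[of "map w [0..<Suc i]"]) (auto simp: cylinder_def simp del: upt_Suc)
    qed (auto simp: cylinder_def)
    also have "\<dots> \<in> ?S"
      by (rule S.countable_UN'') auto
    finally show ?thesis .
  qed
  have "UNIV \<rightarrow>\<^sub>E space (count_space UNIV) = (UNIV :: (nat \<Rightarrow> 'v) set)"
    by (simp add: PiE_UNIV_domain)
  then show "sets path_space \<subseteq> ?S"
    unfolding sets_PiM_single by (simp only:) (rule sigma_sets_mono, clarsimp simp: single)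
  have "cylinder xs \<in> sets path_space" for xs :: "'v list"
  proof -
    have "{w \<in> space path_space. \<forall>i\<in>{..<length xs}. w i = xs ! i} \<in> sets (path_space :: (nat \<Rightarrow> 'v) measure)"
      by measurable
    then show ?thesis by (simp add: cylinder_def Ball_def)
  qed
  then have "insert {} (range cylinder) \<subseteq> sets (path_space :: (nat \<Rightarrow> 'v) measure)" by auto
  from sets.sigma_sets_subset[OF this] show "?S \<subseteq> sets path_space" by simp
qed

lemma emeasure_srw_law_cylinder_snoc:
  fixes x :: "'v::countable"
  shows "emeasure (srw_law E x) (cylinder (xs @ [z, y]))
    = ennreal (pmf (srw_step E z) y) * emeasure (srw_law E x) (cylinder (xs @ [z]))"
proof -
  let ?Q = "\<lambda>w. w \<in> cylinder (xs @ [z])" and ?n = "length xs"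
  have "cylinder (xs @ [z, y]) = {w. ?Q w \<and> w (Suc ?n) = y}"
    by (auto simp: cylinder_def nth_append less_Suc_eq)
  then have "emeasure (srw_law E x) (cylinder (xs @ [z, y])) = emeasure (srw_law E x) {w. ?Q w \<and> w (Suc ?n) = y}"
    by simp
  also have "\<dots> = (\<integral>\<^sup>+a. ennreal (pmf (srw_step E a) y) * emeasure (srw_law E x) {w. ?Q w \<and> w ?n = a} \<partial>count_space UNIV)"
  proof (rule emeasure_srw_law_Suc[where Q="?Q" and n="?n"])
    fix w w' :: "nat \<Rightarrow> 'v" assume "\<And>i. i \<le> ?n \<Longrightarrow> w i = w' i"
    then have "w i = (xs @ [z]) ! i \<longleftrightarrow> w' i = (xs @ [z]) ! i" if "i < length (xs @ [z])" for i
      using that by simp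
    then show "?Q w = ?Q w'" unfolding cylinder_def mem_Collect_eq by blast
  qed
  also have "\<dots> = (\<integral>\<^sup>+a. (ennreal (pmf (srw_step E z) y) * emeasure (srw_law E x) (cylinder (xs @ [z]))) * indicator {z} a \<partial>count_space UNIV)"
  proof (rule nn_integral_cong)
    fix a
    have "w ?n = z" if "?Q w" for w using that by (simp add: cylinder_def)
    then have "{w. ?Q w \<and> w ?n = a} = (if a = z then cylinder (xs @ [z]) else {})" by auto
    then show "ennreal (pmf (srw_step E a) y) * emeasure (srw_law E x) {w. ?Q w \<and> w ?n = a}
       = (ennreal (pmf (srw_step E z) y) * emeasure (srw_law E x) (cylinder (xs @ [z]))) * indicator {z} a"
      by (simp add: indicator_def)
  qed
  also have "\<dots> = ennreal (pmf (srw_step E z) y) * emeasure (srw_law E x) (cylinder (xs @ [z]))"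
    by (subst nn_integral_cmult_indicator) auto
  finally show ?thesis .
qed

context random_rooted_graph
begin

lemma rooted: "\<omega> \<in> space M \<Longrightarrow> rooted_graph (G \<omega>) (E \<omega>) (\<rho> \<omega>)"
  by (intro rooted_graph.intro graph root_in)

text \<open>
  Neighbourhoods are finite subsets of a countable type, so there are countably many possible
  values, and any function of the neighbourhood is measurable in the environment.
\<close>

lemma measurable_nbrs: "(\<lambda>\<omega>. nbrs (E \<omega>) x) \<in> M \<rightarrow>\<^sub>M count_space (Collect finite)"
proof (subst measurable_count_space_eq_countable, simp add: countable_Collect_finite, intro conjI ballI)
  show "(\<lambda>\<omega>. nbrs (E \<omega>) x) \<in> space M \<rightarrow> Collect finite"
    using rooted_graph.finite_nbrs[OF rooted] by auto
  fix S :: "'v set"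
  have "Measurable.pred M (\<lambda>\<omega>. {x, y} \<in> E \<omega>)" for y
    using measurable_edge[of x y] by (simp add: pred_def)
  then have "Measurable.pred M (\<lambda>\<omega>. \<forall>y. {x, y} \<in> E \<omega> \<longleftrightarrow> y \<in> S)" by measurable
  moreover have "(\<lambda>\<omega>. nbrs (E \<omega>) x) -` {S} \<inter> space M = {\<omega> \<in> space M. \<forall>y. {x, y} \<in> E \<omega> \<longleftrightarrow> y \<in> S}"
    by (auto simp: nbrs_def)
  ultimately show "(\<lambda>\<omega>. nbrs (E \<omega>) x) -` {S} \<inter> space M \<in> sets M" by (simp add: pred_def)
qed

lemma measurable_srw_cylinder:
  "(\<lambda>\<omega>. emeasure (srw_law (E \<omega>) (\<rho> \<omega>)) (cylinder xs)) \<in> borel_measurable M"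
proof (induction xs rule: rev_induct)
  case Nil
  have "emeasure (srw_law (E \<omega>) (\<rho> \<omega>)) (cylinder []) = 1" for \<omega>
    using prob_space.emeasure_space_1[OF prob_space_srw_law] by (simp add: cylinder_def)
  then show ?case by simp
next
  case (snoc y xs)
  show ?case
  proof (cases xs rule: rev_cases)
    case Nil
    have "emeasure (srw_law (E \<omega>) (\<rho> \<omega>)) (cylinder [y]) = indicator {\<rho> \<omega>} y" for \<omega>
      by (simp add: cylinder_def emeasure_srw_law_start)
    moreover have "(\<lambda>\<omega>. (\<lambda>z. indicator {z} y :: ennreal) (\<rho> \<omega>)) \<in> borel_measurable M"
      by (rule measurable_compose[OF measurable_root]) simp
    ultimately show ?thesis using Nil by simp
  next
    case (snoc ys z)
    have "(\<lambda>\<omega>. (\<lambda>S. ennreal (pmf (pmf_of_set S) y)) (nbrs (E \<omega>) z)) \<in> borel_measurable M"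
      by (rule measurable_compose[OF measurable_nbrs]) simp
    then have "(\<lambda>\<omega>. ennreal (pmf (srw_step (E \<omega>) z) y)) \<in> borel_measurable M"
      by (simp add: srw_step_def nbrs_def)
    then show ?thesis
      using snoc.IH snoc by (simp add: emeasure_srw_law_cylinder_snoc)
  qed
qed

lemma measurable_srw_law [measurable]:
  "(\<lambda>\<omega>. srw_law (E \<omega>) (\<rho> \<omega>)) \<in> M \<rightarrow>\<^sub>M prob_algebra path_space"
proof (rule measurable_prob_algebraI)
  show "(\<lambda>\<omega>. srw_law (E \<omega>) (\<rho> \<omega>)) \<in> M \<rightarrow>\<^sub>M subprob_algebra path_space"
  proof (rule measurable_subprob_algebra_generated[OF sets_path_space_cylinders Int_stable_cylinders])
    fix A :: "(nat \<Rightarrow> 'v) set" assume "A \<in> insert {} (range cylinder)"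
    then show "(\<lambda>\<omega>. emeasure (srw_law (E \<omega>) (\<rho> \<omega>)) A) \<in> borel_measurable M"
      using measurable_srw_cylinder by auto
  next
    show "(\<lambda>\<omega>. emeasure (srw_law (E \<omega>) (\<rho> \<omega>)) UNIV) \<in> borel_measurable M"
      using measurable_srw_cylinder[of "[]"] by (simp add: cylinder_def)
  qed (auto intro: prob_space_imp_subprob_space prob_space_srw_law)
qed (rule prob_space_srw_law)

text \<open>
  The random vertices \<open>\<rho> \<omega>\<close> and \<open>w n\<close> take countably many values, so they may be fixed.
\<close>

lemma measurable_dist_root:
  "(\<lambda>(\<omega>, w). d \<omega> (\<rho> \<omega>) (w n)) \<in> borel_measurable (M \<Otimes>\<^sub>M path_space)"
proof -
  note measurable_root [measurable] measurable_dist [measurable]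
  have 1: "(\<lambda>p. d (fst p) x y) \<in> borel_measurable (M \<Otimes>\<^sub>M (path_space :: (nat \<Rightarrow> 'v) measure))" for x y
    by measurable
  have 2: "(\<lambda>p. \<rho> (fst p)) \<in> M \<Otimes>\<^sub>M (path_space :: (nat \<Rightarrow> 'v) measure) \<rightarrow>\<^sub>M count_space UNIV" by measurable
  have 3: "(\<lambda>p. snd p n) \<in> M \<Otimes>\<^sub>M (path_space :: (nat \<Rightarrow> 'v) measure) \<rightarrow>\<^sub>M count_space UNIV" by measurable
  show ?thesis
    unfolding case_prod_beta
    by (rule measurable_compose_countable[OF measurable_compose_countable[OF 1 2] 3])
qed

lemma measurable_in_ball:
  "Measurable.pred (M \<Otimes>\<^sub>M path_space) (\<lambda>(\<omega>, w). w n \<in> Metric_space.mball (G \<omega>) (d \<omega>) (\<rho> \<omega>) R)"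
proof -
  have 3: "(\<lambda>p. snd p n) \<in> M \<Otimes>\<^sub>M (path_space :: (nat \<Rightarrow> 'v) measure) \<rightarrow>\<^sub>M count_space UNIV" by measurable
  have "Measurable.pred M (\<lambda>\<omega>. y \<in> G \<omega>)" for y
    using measurable_vertex[of y] by (simp add: pred_def)
  then have "Measurable.pred (M \<Otimes>\<^sub>M (path_space :: (nat \<Rightarrow> 'v) measure)) (\<lambda>p. y \<in> G (fst p))" for y
    by measurable
  from measurable_compose_countable[OF this 3]
  have 4: "Measurable.pred (M \<Otimes>\<^sub>M (path_space :: (nat \<Rightarrow> 'v) measure)) (\<lambda>p. snd p n \<in> G (fst p))" .
  have "Measurable.pred (M \<Otimes>\<^sub>M path_space) (\<lambda>p. snd p n \<in> G (fst p) \<and> (case p of (\<omega>, w) \<Rightarrow> d \<omega> (\<rho> \<omega>) (w n)) < R)"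
    using 4 measurable_dist_root[of n] by measurable
  then show ?thesis
    by (rule measurable_cong[THEN iffD1, rotated])
       (auto simp: space_pair_measure Metric_space.in_mball[OF metric] root_in)
qed

lemma measurable_expected_exit_time [measurable]:
  "(\<lambda>\<omega>. expected_exit_time (G \<omega>) (E \<omega>) (d \<omega>) (\<rho> \<omega>) R) \<in> borel_measurable M"
proof -
  note measurable_in_ball[unfolded case_prod_beta, measurable]
  have "(\<lambda>(\<omega>, w). exit_time (Metric_space.mball (G \<omega>) (d \<omega>) (\<rho> \<omega>) R) w) \<in> borel_measurable (M \<Otimes>\<^sub>M path_space)"
    unfolding exit_time_eq_suminf case_prod_beta by measurable
  then show ?thesis
    unfolding expected_exit_time_def
    by (rule nn_integral_measurable_subprob_algebra2) (rule measurable_prob_algebraD[OF measurable_srw_law])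
qed

lemma measurable_heat_kernel [measurable]:
  "(\<lambda>\<omega>. heat_kernel (E \<omega>) n (\<rho> \<omega>) (\<rho> \<omega>)) \<in> borel_measurable M"
proof -
  have "{w. w n = y} \<in> sets path_space" for y :: 'v
    by (rule sets_walk_at)
  then have "(\<lambda>\<omega>. measure (srw_law (E \<omega>) (\<rho> \<omega>)) {w. w n = y}) \<in> borel_measurable M" for y
    by (intro measure_measurable_subprob_algebra2[where N=path_space] measurable_prob_algebraD[OF measurable_srw_law])
       (auto intro!: pair_measureI simp: Sigma_def[symmetric])
  moreover have "(\<lambda>\<omega>. real (degree (E \<omega>) y)) \<in> borel_measurable M" for y
  proof -
    have "(\<lambda>\<omega>. (\<lambda>S. real (card S)) (nbrs (E \<omega>) y)) \<in> borel_measurable M"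
      by (rule measurable_compose[OF measurable_nbrs]) simp
    then show ?thesis
      by (rule measurable_cong[THEN iffD1, rotated]) (simp add: rooted_graph.degree_eq[OF rooted])
  qed
  ultimately have "(\<lambda>\<omega>. heat_kernel (E \<omega>) n (\<rho> \<omega>) y) \<in> borel_measurable M" for y
    unfolding heat_kernel_def by simp
  from measurable_compose_countable[OF this measurable_root] show ?thesis .
qed

lemma measurable_walk_kernel:
  "(\<lambda>\<omega>. distr (srw_law (E \<omega>) (\<rho> \<omega>)) (M \<Otimes>\<^sub>M path_space) (Pair \<omega>)) \<in> M \<rightarrow>\<^sub>M prob_algebra (M \<Otimes>\<^sub>M path_space)"
  by measurable

lemma space_annealed: "space (annealed_law M E \<rho>) = space M \<times> UNIV"
proof -
  have "space (annealed_law M E \<rho>) = space (M \<Otimes>\<^sub>M (path_space :: (nat \<Rightarrow> 'v) measure))"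
    unfolding annealed_law_def by (rule space_bind) (auto simp: not_empty)
  then show ?thesis by (simp add: space_pair_measure)
qed

lemma prob_space_annealed: "prob_space (annealed_law M E \<rho>)"
  unfolding annealed_law_def
  by (rule prob_space_bind[OF _ measurable_prob_algebraD[OF measurable_walk_kernel]])
    (auto intro!: AE_I2 prob_space.prob_space_distr prob_space_srw_law)

text \<open>
  A quenched lower bound on an event of environments integrates to an annealed one.
\<close>

lemma annealed_ge:
  assumes A: "A \<in> sets (M \<Otimes>\<^sub>M path_space)" and H: "H \<in> sets M"
    and c: "0 \<le> c" "\<And>\<omega>. \<omega> \<in> H \<Longrightarrow> c \<le> measure (srw_law (E \<omega>) (\<rho> \<omega>)) {w. (\<omega>, w) \<in> A}"
  shows "c * prob H \<le> measure (annealed_law M E \<rho>) A"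
proof -
  let ?K = "\<lambda>\<omega>. distr (srw_law (E \<omega>) (\<rho> \<omega>)) (M \<Otimes>\<^sub>M path_space) (Pair \<omega>)"
  have K: "?K \<in> M \<rightarrow>\<^sub>M subprob_algebra (M \<Otimes>\<^sub>M path_space)"
    by (rule measurable_prob_algebraD[OF measurable_walk_kernel])
  interpret A: prob_space "annealed_law M E \<rho>"
    by (rule prob_space_annealed)
  have "ennreal (c * prob H) = (\<integral>\<^sup>+\<omega>. ennreal c * indicator H \<omega> \<partial>M)"
    using H c(1) by (simp add: nn_integral_cmult_indicator emeasure_eq_measure ennreal_mult)
  also have "\<dots> \<le> (\<integral>\<^sup>+\<omega>. emeasure (?K \<omega>) A \<partial>M)"
  proof (rule nn_integral_mono)
    fix \<omega> assume \<omega>: "\<omega> \<in> space M"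
    interpret W: prob_space "srw_law (E \<omega>) (\<rho> \<omega>)" by (rule prob_space_srw_law)
    have "emeasure (?K \<omega>) A = ennreal (measure (srw_law (E \<omega>) (\<rho> \<omega>)) {w. (\<omega>, w) \<in> A})"
      using \<omega> A by (subst emeasure_distr) (auto simp: W.emeasure_eq_measure vimage_def)
    then show "ennreal c * indicator H \<omega> \<le> emeasure (?K \<omega>) A"
      using c by (auto simp: indicator_def intro!: ennreal_leI)
  qed
  also have "\<dots> = emeasure (annealed_law M E \<rho>) A"
    unfolding annealed_law_def by (rule emeasure_bind[OF not_empty K A, symmetric])
  finally show ?thesis
    by (simp add: A.emeasure_eq_measure ennreal_le_iff)
qed

end

section \<open>Growth functions\<close>

lemma growth_1: "growth_function f C a b \<Longrightarrow> f 1 = 1"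
  unfolding growth_function_def by blast

lemma growth_mono: "growth_function f C a b \<Longrightarrow> 0 \<le> x \<Longrightarrow> x \<le> y \<Longrightarrow> f x \<le> f y"
  unfolding growth_function_def by (auto dest!: strict_mono_on_imp_mono_on intro: mono_onD)

lemma growth_pos: "growth_function f C a b \<Longrightarrow> 0 < x \<Longrightarrow> 0 < f x"
  unfolding growth_function_def by (metis atLeast_iff less_imp_le order_refl strict_mono_onD)

lemma growth_nonneg: "growth_function f C a b \<Longrightarrow> 0 \<le> x \<Longrightarrow> 0 \<le> f x"
  using growth_mono[of f C a b 0 x] unfolding growth_function_def by simp

lemma growth_upper:
  assumes f: "growth_function f C a b" and R: "0 < R" "1 \<le> K"
  shows "f (K * R) \<le> C * K powr b * f R"
proof -
  have "R \<le> K * R" using R by simp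
  then have "f (K * R) / f R \<le> C * (K * R / R) powr b"
    using f R(1) unfolding growth_function_def by blast
  then show ?thesis using growth_pos[OF f R(1)] R by (simp add: pos_divide_le_eq)
qed

lemma growth_lower:
  assumes f: "growth_function f C a b" and R: "0 < R" "1 \<le> K" "1 \<le> C"
  shows "K powr a * f R \<le> C * f (K * R)"
proof -
  have "R \<le> K * R" using R by simp
  then have "inverse C * (K * R / R) powr a \<le> f (K * R) / f R"
    using f R(1) unfolding growth_function_def by blast
  then have "inverse C * (K powr a * f R) \<le> f (K * R)"
    using growth_pos[OF f R(1)] R by (simp add: pos_le_divide_eq mult.assoc)
  then show ?thesis using R(3) by (simp add: field_simps)
qed

text \<open>
  The lower growth exponent is positive, so changing scale by a large factor makes the growth
  function as small as desired in proportion, uniformly in the scale.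
\<close>

lemma growth_shrink:
  assumes f: "growth_function f C a b" and C: "1 \<le> C" "0 < a" and \<eta>: "0 < \<eta>"
  shows "\<exists>L\<ge>1. \<forall>K\<ge>L. \<forall>x>0. f x \<le> \<eta> * f (K * x)"
proof -
  define L where "L = max 1 ((C / \<eta>) powr (1 / a))"
  have "f x \<le> \<eta> * f (K * x)" if K: "L \<le> K" and x: "0 < x" for K x
  proof -
    have K1: "1 \<le> K" using K by (simp add: L_def)
    have "C / \<eta> = ((C / \<eta>) powr (1 / a)) powr a" using C \<eta> by (simp add: powr_powr)
    also have "\<dots> \<le> K powr a" using K C by (intro powr_mono2) (auto simp: L_def)
    finally have "C / \<eta> * f x \<le> K powr a * f x" using growth_pos[OF f x] by (intro mult_right_mono) auto
    also have "\<dots> \<le> C * f (K * x)" by (rule growth_lower[OF f x K1 C(1)])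
    finally show ?thesis using C \<eta> by (simp add: field_simps)
  qed
  then show ?thesis by (intro exI[of _ L]) (auto simp: L_def)
qed

lemma growth_expand:
  assumes f: "growth_function f C a b" and K: "1 \<le> K"
  shows "\<exists>D\<ge>1. \<forall>x>0. f (K * x) \<le> D * f x"
proof -
  let ?D = "max 1 (C * K powr b)"
  have "f (K * x) \<le> ?D * f x" if x: "0 < x" for x
    using growth_pos[OF f x]
    by (intro order_trans[OF growth_upper[OF f x K]] mult_right_mono) auto
  then show ?thesis by (intro exI[of _ ?D]) auto
qed

text \<open>
  The range of \<open>v r\<close> on \<open>[1, \<infinity>)\<close> contains \<open>[1, \<infinity>)\<close> by the intermediate value theorem; to the left of \<open>1\<close>
  the product is less than \<open>1\<close>.
\<close>

lemma scale_inverse_props: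
  assumes v: "growth_function v C\<^sub>1 d\<^sub>1 d\<^sub>2" and r: "growth_function r C\<^sub>2 \<alpha>\<^sub>1 \<alpha>\<^sub>2"
    and C: "1 \<le> C\<^sub>1" "1 \<le> d\<^sub>1" and t: "1 \<le> t"
  shows "1 \<le> scale_inverse v r t" "v (scale_inverse v r t) * r (scale_inverse v r t) = t"
proof -
  let ?f = "\<lambda>R. v R * r R"
  \<comment> \<open>An upper end of the bracket: \<open>v N \<ge> N / C\<^sub>1 = t\<close> because the exponent of \<open>v\<close> is at least \<open>1\<close>, and \<open>r N \<ge> 1\<close>.\<close>
  define N where "N = C\<^sub>1 * t"
  have N: "1 \<le> N" unfolding N_def using C t mult_mono[of 1 "C\<^sub>1" 1 t] by simp
  have v1: "v 1 = 1" "r 1 = 1" by (rule growth_1[OF v], rule growth_1[OF r])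
  have "N \<le> N powr d\<^sub>1" using N C(2) powr_mono[of 1 "d\<^sub>1" N] by simp
  also have "\<dots> \<le> C\<^sub>1 * v N" using growth_lower[OF v, of 1 N] N C v1 by simp
  finally have "t \<le> v N" using C(1) unfolding N_def by simp
  moreover have "1 \<le> r N" using growth_mono[OF r, of 1 N] N v1 by simp
  ultimately have "t \<le> ?f N" using t mult_mono[of t "v N" 1 "r N"] by simp
  moreover have "continuous_on {1..N} ?f"
    using v r unfolding growth_function_def
    by (intro continuous_on_mult) (auto intro: continuous_on_subset)
  ultimately obtain x where x: "1 \<le> x" "?f x = t"
    using IVT'[of ?f 1 t N] N t v1 by auto
  then have "t \<in> ?f ` {0..}" by (auto intro!: image_eqI[of _ _ x])
  from f_inv_into_f[OF this] inv_into_into[OF this]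
  show I: "v (scale_inverse v r t) * r (scale_inverse v r t) = t"
    and "1 \<le> scale_inverse v r t"
  proof -
    let ?I = "scale_inverse v r t"
    assume I: "v (inv_into {0..} ?f t) * r (inv_into {0..} ?f t) = t" "inv_into {0..} ?f t \<in> {0..}"
    then show "v ?I * r ?I = t" by (simp add: scale_inverse_def)
    have I': "v ?I * r ?I = t" "0 \<le> ?I" using I by (auto simp: scale_inverse_def)
    show "1 \<le> ?I"
    proof (rule ccontr)
      assume "\<not> 1 \<le> ?I"
      then have "?I < 1" by simp
      then have "v ?I < 1" using v I'(2) v1 strict_mono_onD[of "{0..}" v ?I 1] by (simp add: growth_function_def)
      moreover have "r ?I \<le> 1" using growth_mono[OF r I'(2), of 1] \<open>?I < 1\<close> v1 by simp
      ultimately have "v ?I * r ?I \<le> v ?I * 1"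
        using growth_nonneg[OF v I'(2)] by (intro mult_left_mono)
      then show False using \<open>v ?I < 1\<close> I'(1) t by simp
    qed
  qed
qed

section \<open>Estimates at good radii of one graph\<close>

locale metric_rooted_graph = rooted_graph G E x\<^sub>0 + Metric_space G d
  for G :: "'v::countable set" and E and x\<^sub>0 and d :: "'v \<Rightarrow> 'v \<Rightarrow> real" +
  fixes v r :: "real \<Rightarrow> real" and C\<^sub>1 C\<^sub>2 d\<^sub>1 d\<^sub>2 \<alpha>\<^sub>1 \<alpha>\<^sub>2 lam :: real
  assumes v: "growth_function v C\<^sub>1 d\<^sub>1 d\<^sub>2" and r: "growth_function r C\<^sub>2 \<alpha>\<^sub>1 \<alpha>\<^sub>2"
    and lam: "1 \<le> lam"
begin

abbreviation rball where "rball R \<equiv> mball x\<^sub>0 R"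

abbreviation good where "good R \<equiv> R \<in> good_radii G E d x\<^sub>0 v r lam"

lemma root_in_ball: "0 < R \<Longrightarrow> x\<^sub>0 \<in> rball R"
  using root by simp

text \<open>
  The defining bounds in terms of real numbers, with \<open>r (d x\<^sub>0 y)\<close> bounded by \<open>r R\<close>.
\<close>

lemma goodD:
  assumes "good R"
  shows "1 \<le> R" "finite (rball R)" "v R \<le> lam * vol (rball R)" "vol (rball R) \<le> lam * v R"
    "ennreal (r R / lam) \<le> eff_resistance E {x\<^sub>0} (G - rball R)"
    "\<And>y. y \<in> rball R \<Longrightarrow> eff_resistance E {x\<^sub>0} {y} \<le> ennreal (lam * r R)"
    "0 < v R" "0 < r R" "0 < vol (rball R)"
proof -
  note good = assms[unfolded good_radii_def volume_def mem_Collect_eq]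
  show "1 \<le> R" using good by simp
  then show pos: "0 < v R" "0 < r R" using growth_pos[OF v] growth_pos[OF r] by auto
  have sub: "rball R \<subseteq> G" by auto
  from good have le: "emeasure (vertex_measure G E) (rball R) \<le> ennreal (lam * v R)" by simp
  note V = volume_leD[OF sub le]
  show "finite (rball R)" by (rule V)
  have "0 \<le> vol (rball R)" by (simp add: vol_def sum_nonneg)
  then have "inverse lam * v R \<le> vol (rball R)" "vol (rball R) \<le> lam * v R"
    using good lam pos unfolding V(2) by (auto simp: ennreal_le_iff)
  then show "v R \<le> lam * vol (rball R)" "vol (rball R) \<le> lam * v R"
    using lam by (auto simp: field_simps)
  then show "0 < vol (rball R)" using pos lam by (smt (verit) mult_le_0_iff)
  show "ennreal (r R / lam) \<le> eff_resistance E {x\<^sub>0} (G - rball R)"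
    using good by (simp add: inverse_eq_divide mult.commute)
  fix y assume y: "y \<in> rball R"
  then have "eff_resistance E {x\<^sub>0} {y} \<le> ennreal (lam * r (d x\<^sub>0 y))" using good by simp
  also have "\<dots> \<le> ennreal (lam * r R)"
    using y lam growth_mono[OF r, of "d x\<^sub>0 y" R] by (intro ennreal_leI mult_left_mono) auto
  finally show "eff_resistance E {x\<^sub>0} {y} \<le> ennreal (lam * r R)" .
qed

lemma green_root_le_good:
  assumes S: "good S" and B: "x\<^sub>0 \<in> B"
  shows "green B n x\<^sub>0 \<le> 2 * lam * n / v S + lam * r S"
proof -
  note g = goodD[OF S]
  have "green B n x\<^sub>0 \<le> 2 * real n / vol (rball S) + lam * r S"
    using g lam by (intro green_root_le_volume B) auto
  also have "2 * real n / vol (rball S) \<le> 2 * real n / (v S / lam)"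
    using g lam by (intro divide_left_mono) (auto simp: field_simps)
  finally show ?thesis by (simp add: mult_ac)
qed

text \<open>
  The bound for the Green function at the scale \<open>S\<close> of the time \<open>n\<close>, against the resistance
  across \<open>rball R\<close>.
\<close>

lemma exit_probability_le_good:
  assumes S: "good S" and R: "good R" and n: "n \<le> c * (v S * r S)"
  shows "(1 - stay (rball R) n)\<^sup>2 \<le> (2 * c + 1) * lam\<^sup>2 * (r S / r R)"
proof -
  note g = goodD[OF S] and h = goodD[OF R]
  have B: "x\<^sub>0 \<in> rball R" using root_in_ball h by simp
  have "(1 - stay (rball R) n)\<^sup>2 \<le> green (rball R) n x\<^sub>0 / (r R / lam)"
    using h lam by (intro exit_probability_le B finite_Int) auto
  also have "\<dots> \<le> ((2 * c + 1) * lam * r S) / (r R / lam)"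
  proof (rule divide_right_mono)
    have "green (rball R) n x\<^sub>0 \<le> 2 * lam * n / v S + lam * r S"
      by (rule green_root_le_good[OF S B])
    also have "2 * lam * n / v S \<le> 2 * lam * (c * (v S * r S)) / v S"
      using n g lam by (intro divide_right_mono mult_left_mono) auto
    finally show "green (rball R) n x\<^sub>0 \<le> (2 * c + 1) * lam * r S"
      using g by (simp add: algebra_simps)
  qed (use h lam in simp)
  finally show ?thesis by (simp add: power2_eq_square mult_ac)
qed

text \<open>
  \<open>green UNIV (2 * n + 1)\<close> at the root is at most \<open>6 lam n / v S + lam r S\<close>, and \<open>r S = n / v S\<close> at the
  scale of \<open>n\<close>.
\<close>

lemma heat_upper_good:
  assumes S: "good S" and n: "1 \<le> n" "v S * r S = real n"
  shows "v S * killed UNIV (2 * n) x\<^sub>0 \<le> 7 * lam"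
proof -
  note g = goodD[OF S]
  have "n * killed UNIV (2 * n) x\<^sub>0 \<le> green UNIV (2 * n + 1) x\<^sub>0"
    by (rule heat_even_le_green)
  also have "\<dots> \<le> 2 * lam * (2 * n + 1) / v S + lam * r S"
    using green_root_le_good[OF S, of UNIV "2 * n + 1"] by simp
  also have "2 * lam * (2 * n + 1) / v S \<le> 2 * lam * (3 * n) / v S"
    using g lam n by (intro divide_right_mono mult_left_mono) auto
  also have "lam * r S = lam * n / v S" using g n(2) by (simp add: field_simps)
  finally have "n * killed UNIV (2 * n) x\<^sub>0 \<le> 7 * lam * n / v S" by (simp add: add_divide_distrib[symmetric])
  then have "n * (v S * killed UNIV (2 * n) x\<^sub>0) \<le> n * (7 * lam)"
    using g by (simp add: pos_le_divide_eq mult_ac)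
  then show ?thesis using n(1) by simp
qed

lemma heat_lower_good:
  assumes R: "good R" and stay: "1 / 2 \<le> stay (rball R) n"
  shows "1 \<le> 4 * lam * v R * killed UNIV (2 * n) x\<^sub>0"
proof -
  note h = goodD[OF R]
  have "(1 / 2)\<^sup>2 \<le> (measure (srw_law E x\<^sub>0) {w. w n \<in> rball R})\<^sup>2"
    using stay stay_le_walk_in[of "rball R" n] by (intro power_mono) auto
  also have "\<dots> \<le> vol (rball R) * killed UNIV (2 * n) x\<^sub>0" by (rule walk_in_le[OF h(2)])
  also have "\<dots> \<le> lam * v R * killed UNIV (2 * n) x\<^sub>0"
    by (intro mult_right_mono h killed_nonneg)
  finally show ?thesis by (simp add: power2_eq_square)
qed

lemma walk_in_ball_le_good:
  assumes R: "good R" and S: "good S" and n: "1 \<le> n" "v S * r S = real n"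
  shows "(measure (srw_law E x\<^sub>0) {w. w n \<in> rball R})\<^sup>2 \<le> 7 * lam\<^sup>2 * (v R / v S)"
proof -
  note g = goodD[OF S] and h = goodD[OF R]
  have "(measure (srw_law E x\<^sub>0) {w. w n \<in> rball R})\<^sup>2 \<le> vol (rball R) * killed UNIV (2 * n) x\<^sub>0"
    by (rule walk_in_le[OF h(2)])
  also have "\<dots> \<le> (lam * v R) * (7 * lam / v S)"
    using heat_upper_good[OF S n] g h lam
    by (intro mult_mono) (auto simp: killed_nonneg field_simps)
  finally show ?thesis by (simp add: power2_eq_square mult_ac)
qed

text \<open>
  The volume bounds give a point \<open>z\<close> of \<open>rball R'\<close> outside \<open>rball R\<close>. The killed Green function vanishes
  there, so its value at the root, and then all its values on \<open>rball R\<close>, are at most of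
  order \<open>r R'\<close>, for every time horizon.
\<close>

lemma exit_time_le_good:
  assumes R: "good R" and R': "good R'" and less: "lam\<^sup>2 * v R < v R'"
  shows "expected_exit_time G E d x\<^sub>0 R \<le> ennreal (2 * lam\<^sup>2 * (v R * r R'))"
  unfolding expected_exit_time_def
proof (rule expected_exit_time_le)
  fix n
  note h = goodD[OF R] and h' = goodD[OF R']
  let ?L = "lam * r R'" and ?B = "rball R"
  have B: "x\<^sub>0 \<in> ?B" using root_in_ball h by simp
  have L: "0 \<le> ?L" using h' lam by simp
  have "lam\<^sup>2 * v R < lam * vol (rball R')" using less h'(3) by linarith
  then have "lam * (lam * v R) < lam * vol (rball R')" by (simp only: power2_eq_square mult.assoc)
  then have "lam * v R < vol (rball R')" using lam by simp
  then have vol_less: "vol ?B < vol (rball R')" using h(4) by linarith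
  have "\<not> rball R' \<subseteq> ?B"
  proof
    assume "rball R' \<subseteq> ?B"
    then have "vol (rball R') \<le> vol ?B" unfolding vol_def using h(2) by (intro sum_mono2) auto
    then show False using vol_less by simp
  qed
  then obtain z where z: "z \<in> rball R'" "z \<notin> ?B" by blast
  have "1 * v R \<le> lam\<^sup>2 * v R" using lam h(7) by (intro mult_right_mono) auto
  then have "v R < v R'" using less by linarith
  then have "R \<le> R'" using growth_mono[OF v, of R' R] h'(1) by linarith
  then have sub: "?B \<subseteq> rball R'" by auto
  have "green ?B n z = 0" using z(2) by (intro green_outside B) blast
  then have g0: "green ?B n x\<^sub>0 \<le> ?L"
    using green_root_le[OF B h'(6)[OF z(1)] L, of n] by linarith
  have "(\<Sum>k<n. stay ?B k) = (\<Sum>k<n. \<Sum>y\<in>?B. degree E y * killed ?B k y)"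
    using B h(2) by (intro sum.cong refl stay_eq_sum) (auto simp: killed_outside)
  also have "\<dots> = (\<Sum>y\<in>?B. degree E y * green ?B n y)"
    unfolding green_def by (subst sum.swap) (simp add: sum_distrib_left)
  also have "\<dots> \<le> (\<Sum>y\<in>?B. degree E y * (2 * ?L))"
  proof (intro sum_mono mult_left_mono)
    fix y assume "y \<in> ?B"
    then have "green ?B n y \<le> (3 * green ?B n x\<^sub>0 + ?L) / 2"
      using sub by (intro green_le_root[OF B _ L] h'(6)) auto
    then show "green ?B n y \<le> 2 * ?L" using g0 by simp
  qed simp
  also have "\<dots> = vol ?B * (2 * ?L)" unfolding vol_def by (rule sum_distrib_right[symmetric])
  also have "\<dots> \<le> (lam * v R) * (2 * ?L)" using L by (intro mult_right_mono[OF h(4)]) simp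
  finally show "(\<Sum>k<n. stay ?B k) \<le> 2 * lam\<^sup>2 * (v R * r R')"
    by (simp add: power2_eq_square mult_ac)
qed

lemma exit_time_ge_1:
  assumes "0 < R" shows "1 \<le> expected_exit_time G E d x\<^sub>0 R"
proof -
  interpret W: prob_space "srw_law E x\<^sub>0" by (rule prob_space_srw_law)
  have "1 = W.prob {w. w 0 = x\<^sub>0}"
    using emeasure_srw_law_start[of E x\<^sub>0 x\<^sub>0] by (simp add: measure_def)
  also have "\<dots> \<le> stay (rball R) 0"
    unfolding stay_def
  proof (rule W.finite_measure_mono)
    show "{w :: nat \<Rightarrow> 'v. w 0 = x\<^sub>0} \<subseteq> {w. \<forall>i\<le>0. w i \<in> rball R}"
      using root_in_ball[OF assms] by auto
    show "{w. \<forall>i\<le>0. w i \<in> rball R} \<in> W.events" by (simp only: sets_srw_law sets_stay)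
  qed
  finally have "1 \<le> ennreal (stay (rball R) 0)" by simp
  also have "\<dots> \<le> (\<Sum>k. ennreal (stay (rball R) k))"
    using sum_le_suminf[of "\<lambda>k. ennreal (stay (rball R) k)" "{0}"] by simp
  finally show ?thesis unfolding expected_exit_time_def expected_exit_time_eq .
qed

text \<open>
  Up to the time \<open>n\<close> of order \<open>v S r S\<close> the walk leaves \<open>rball R\<close> with probability at most \<open>1 / 2\<close>.
  Rounding that time up to an integer at most doubles it, as it is at least \<open>1\<close>, whence the factor
  \<open>5 = 2 * 2 + 1\<close> in the hypothesis.
\<close>

lemma exit_time_ge_good:
  assumes S: "good S" and R: "good R" and small: "5 * lam\<^sup>2 * (r S / r R) \<le> 1 / 4"
  shows "ennreal (v S * r S / 2) \<le> expected_exit_time G E d x\<^sub>0 R"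
proof -
  note g = goodD[OF S]
  define t where "t = v S * r S"
  have "1 \<le> v S" "1 \<le> r S"
    using growth_mono[OF v, of 1 S] growth_mono[OF r, of 1 S] growth_1[OF v] growth_1[OF r] g(1) by simp_all
  then have t: "1 \<le> t" unfolding t_def using mult_mono[of 1 "v S" 1 "r S"] by simp
  define n where "n = nat \<lceil>t\<rceil>"
  have n: "t \<le> n" "n \<le> 2 * t" using t unfolding n_def by linarith+
  have "(1 - stay (rball R) n)\<^sup>2 \<le> (2 * 2 + 1) * lam\<^sup>2 * (r S / r R)"
    using n(2) unfolding t_def by (rule exit_probability_le_good[OF S R])
  also have "\<dots> \<le> (1 / 2)\<^sup>2" using small by (simp add: power2_eq_square)
  finally have "1 - stay (rball R) n \<le> 1 / 2" by (rule power2_le_imp_le) simp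
  then have "t * (1 / 2) \<le> n * stay (rball R) n" using n t by (intro mult_mono) auto
  then have "ennreal (t / 2) \<le> ennreal (n * stay (rball R) n)" by (intro ennreal_leI) simp
  also have "\<dots> \<le> expected_exit_time G E d x\<^sub>0 R"
    unfolding expected_exit_time_def by (rule expected_exit_time_ge)
  finally show ?thesis unfolding t_def .
qed

text \<open>
  Off the vertex set the distances carry no information, so a bound on the distance of the walk from
  the root has to use that the walk never leaves the graph.
\<close>

lemma walk_in_graph: "measure (srw_law E x\<^sub>0) {w. w n \<in> G} = 1"
proof -
  interpret W: prob_space "srw_law E x\<^sub>0" by (rule prob_space_srw_law)
  let ?F = "{y. killed UNIV n y \<noteq> 0}"
  have F: "?F \<subseteq> G" using killed_outside_graph[of _ UNIV n] by auto
  have G: "{w. w n \<in> G} \<in> sets path_space" by (rule sets_walk_at)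
  have "1 = stay UNIV n" unfolding stay_def using W.prob_space by simp
  also have "\<dots> = (\<Sum>y\<in>?F. degree E y * killed UNIV n y)"
    by (rule stay_eq_sum) (auto simp: finite_support_killed)
  also have "\<dots> = measure (srw_law E x\<^sub>0) {w. w n \<in> ?F}"
    by (rule measure_walk_in[OF finite_support_killed, symmetric])
  also have "\<dots> \<le> measure (srw_law E x\<^sub>0) {w. w n \<in> G}" using F G by (intro W.finite_measure_mono) auto
  finally show ?thesis using W.prob_le_1[of "{w. w n \<in> G}"] by simp
qed

end

section \<open>Bounds with high probability\<close>

text \<open>
  The standing situation once \<open>lam\<close> is fixed: every radius is good with probability at least \<open>1 - \<delta>\<close>.
\<close>

locale good_random_graph = random_rooted_graph M G E d \<rho>
  for M :: "'w measure" and G :: "'w \<Rightarrow> ('v :: countable) set" and E d \<rho> +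
  fixes v r :: "real \<Rightarrow> real" and C\<^sub>1 C\<^sub>2 d\<^sub>1 d\<^sub>2 \<alpha>\<^sub>1 \<alpha>\<^sub>2 lam \<delta> :: real
  assumes v: "growth_function v C\<^sub>1 d\<^sub>1 d\<^sub>2" and r: "growth_function r C\<^sub>2 \<alpha>\<^sub>1 \<alpha>\<^sub>2"
    and constants: "1 \<le> C\<^sub>1" "1 \<le> C\<^sub>2" "1 \<le> d\<^sub>1" "0 < \<alpha>\<^sub>1"
    and lam: "1 \<le> lam" and \<delta>: "0 < \<delta>" "\<delta> < 1"
    and prob_good: "\<And>R. 1 \<le> R \<Longrightarrow>
      1 - \<delta> \<le> prob {\<omega> \<in> space M. R \<in> good_radii (G \<omega>) (E \<omega>) (d \<omega>) (\<rho> \<omega>) v r lam}"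
begin

definition Good :: "real \<Rightarrow> 'w set" where
  "Good R = {\<omega> \<in> space M. R \<in> good_radii (G \<omega>) (E \<omega>) (d \<omega>) (\<rho> \<omega>) v r lam}"

text \<open>
  Measurability of the event comes from the hypothesis itself: a set that is not an event has measure
  \<open>0\<close>, which is less than \<open>1 - \<delta>\<close>.
\<close>

lemma Good_sets: "1 \<le> R \<Longrightarrow> Good R \<in> events"
proof (rule ccontr)
  assume "1 \<le> R" "Good R \<notin> events"
  then show False using prob_good[of R] \<delta> measure_notin_sets[of "Good R" M] by (simp add: Good_def)
qed

lemma prob_Good: "1 \<le> R \<Longrightarrow> 1 - \<delta> \<le> prob (Good R)"
  unfolding Good_def by (rule prob_good)

lemma prob_Int_ge: "A \<in> events \<Longrightarrow> B \<in> events \<Longrightarrow> prob A + prob B - 1 \<le> prob (A \<inter> B)"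
  using finite_measure_Union'[of A B] finite_measure_Diff'[of B A] prob_le_1[of "A \<union> B"]
  by (simp add: Int_commute)

lemma quenched: "\<omega> \<in> space M \<Longrightarrow>
  metric_rooted_graph (G \<omega>) (E \<omega>) (\<rho> \<omega>) (d \<omega>) v r C\<^sub>1 C\<^sub>2 d\<^sub>1 d\<^sub>2 \<alpha>\<^sub>1 \<alpha>\<^sub>2 lam"
  by (intro metric_rooted_graph.intro metric_rooted_graph_axioms.intro rooted metric v r lam)

lemma exit_time_tight:
  "\<exists>\<theta>\<^sub>0. \<forall>\<theta>\<ge>\<theta>\<^sub>0. \<forall>R\<ge>1. 1 - 3 * \<delta> \<le> prob {\<omega> \<in> space M.
     ennreal (inverse \<theta>) \<le> expected_exit_time (G \<omega>) (E \<omega>) (d \<omega>) (\<rho> \<omega>) R / ennreal (v R * r R) \<and>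
     expected_exit_time (G \<omega>) (E \<omega>) (d \<omega>) (\<rho> \<omega>) R / ennreal (v R * r R) \<le> ennreal \<theta>}"
proof -
  \<comment> \<open>\<open>K\<close> makes the volume of \<open>B(K R)\<close> exceed that of \<open>B(R)\<close>; \<open>L\<close> makes \<open>B(R / L)\<close> so small that the walk is unlikely to leave \<open>B(R)\<close> on its time scale.\<close>
  obtain K where K: "1 \<le> K" "\<And>x. 0 < x \<Longrightarrow> v x \<le> 1 / (2 * lam\<^sup>2) * v (K * x)"
    using growth_shrink[OF v, of "1 / (2 * lam\<^sup>2)"] constants lam by auto
  obtain D\<^sub>0 where D0: "1 \<le> D\<^sub>0" "\<And>x. 0 < x \<Longrightarrow> r (K * x) \<le> D\<^sub>0 * r x"
    using growth_expand[OF r K(1)] by auto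
  obtain L where L: "1 \<le> L" "\<And>x. 0 < x \<Longrightarrow> r x \<le> 1 / (20 * lam\<^sup>2) * r (L * x)"
    using growth_shrink[OF r, of "1 / (20 * lam\<^sup>2)"] constants lam by auto
  obtain D\<^sub>1 where D1: "1 \<le> D\<^sub>1" "\<And>x. 0 < x \<Longrightarrow> v (L * x) \<le> D\<^sub>1 * v x"
    using growth_expand[OF v L(1)] by auto
  obtain D\<^sub>2 where D2: "1 \<le> D\<^sub>2" "\<And>x. 0 < x \<Longrightarrow> r (L * x) \<le> D\<^sub>2 * r x"
    using growth_expand[OF r L(1)] by auto
  define D where "D = D\<^sub>1 * D\<^sub>2"
  have D: "1 \<le> D" unfolding D_def using D1(1) D2(1) mult_mono[of 1 "D\<^sub>1" 1 "D\<^sub>2"] by simp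
  have vr: "v (L * x) * r (L * x) \<le> D * (v x * r x)" if x: "0 < x" for x
  proof -
    have "v (L * x) * r (L * x) \<le> (D\<^sub>1 * v x) * (D\<^sub>2 * r x)"
      using x L(1) D1 D2 growth_pos[OF v] growth_pos[OF r]
      by (intro mult_mono) (auto intro!: less_imp_le mult_nonneg_nonneg)
    then show ?thesis by (simp add: D_def mult_ac)
  qed
  define \<theta>\<^sub>0 where "\<theta>\<^sub>0 = max (2 * lam\<^sup>2 * D\<^sub>0) (2 * D)"
  show ?thesis
  proof (intro exI[of _ \<theta>\<^sub>0] allI impI)
    fix \<theta> R :: real
    assume \<theta>: "\<theta>\<^sub>0 \<le> \<theta>" and R: "1 \<le> R"
    let ?Q = "\<lambda>\<omega>. expected_exit_time (G \<omega>) (E \<omega>) (d \<omega>) (\<rho> \<omega>) R"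
    \<comment> \<open>Radii below \<open>1\<close> are never good. If \<open>R / L < 1\<close> then \<open>v R r R\<close> is bounded, and the trivial bound \<open>1\<close> for the exit time suffices.\<close>
    define S where "S = max 1 (R / L)"
    define c where "c = v R * r R"
    have c: "0 < c" unfolding c_def using R growth_pos[OF v] growth_pos[OF r] by simp
    have \<theta>_pos: "0 < \<theta>" using \<theta> D unfolding \<theta>\<^sub>0_def by simp
    have KR: "1 \<le> K * R" using K(1) R mult_mono[of 1 K 1 R] by simp
    have S: "1 \<le> S" unfolding S_def by simp
    let ?H = "Good R \<inter> Good (K * R) \<inter> Good S"
    have H: "?H \<in> events" "1 - 3 * \<delta> \<le> prob ?H"
      using Good_sets[OF R] Good_sets[OF KR] Good_sets[OF S] prob_Good[OF R] prob_Good[OF KR] prob_Good[OF S]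
        prob_Int_ge[of "Good R" "Good (K * R)"] prob_Int_ge[of "Good R \<inter> Good (K * R)" "Good S"] by auto
    note H(2)
    also have "prob ?H \<le> prob {\<omega> \<in> space M. ennreal (inverse \<theta>) \<le> ?Q \<omega> / ennreal c \<and> ?Q \<omega> / ennreal c \<le> ennreal \<theta>}"
    proof (rule finite_measure_mono)
      show "{\<omega> \<in> space M. ennreal (inverse \<theta>) \<le> ?Q \<omega> / ennreal c \<and> ?Q \<omega> / ennreal c \<le> ennreal \<theta>} \<in> events"
        by measurable
      show "?H \<subseteq> {\<omega> \<in> space M. ennreal (inverse \<theta>) \<le> ?Q \<omega> / ennreal c \<and> ?Q \<omega> / ennreal c \<le> ennreal \<theta>}"
      proof
        fix \<omega> assume \<omega>: "\<omega> \<in> ?H"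
        then have \<omega>M: "\<omega> \<in> space M" by (simp add: Good_def)
        interpret Q: metric_rooted_graph "G \<omega>" "E \<omega>" "\<rho> \<omega>" "d \<omega>" v r "C\<^sub>1" "C\<^sub>2" "d\<^sub>1" "d\<^sub>2" "\<alpha>\<^sub>1" "\<alpha>\<^sub>2" lam
          by (rule quenched[OF \<omega>M])
        have good: "Q.good R" "Q.good (K * R)" "Q.good S" using \<omega> by (auto simp: Good_def)
        have lam2: "0 < lam\<^sup>2" using lam by simp
        have vR: "0 < v R" "0 < r R" using R growth_pos[OF v] growth_pos[OF r] by auto
        have "2 * (lam\<^sup>2 * v R) \<le> v (K * R)" using K(2)[of R] R lam2 by (simp add: field_simps)
        moreover have "0 < lam\<^sup>2 * v R" using lam2 vR by simp
        ultimately have "lam\<^sup>2 * v R < v (K * R)" by linarith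
        from Q.exit_time_le_good[OF good(1,2) this]
        have "?Q \<omega> \<le> ennreal (2 * lam\<^sup>2 * (v R * r (K * R)))" .
        also have "\<dots> \<le> ennreal (c * \<theta>)"
        proof (rule ennreal_leI)
          have "2 * lam\<^sup>2 * (v R * r (K * R)) \<le> 2 * lam\<^sup>2 * (v R * (D\<^sub>0 * r R))"
            using D0(2)[of R] R lam2 vR by (intro mult_left_mono) auto
          also have "\<dots> = c * (2 * lam\<^sup>2 * D\<^sub>0)" by (simp add: c_def mult_ac)
          also have "\<dots> \<le> c * \<theta>" using \<theta> c unfolding \<theta>\<^sub>0_def by (intro mult_left_mono) auto
          finally show "2 * lam\<^sup>2 * (v R * r (K * R)) \<le> c * \<theta>" .
        qed
        finally have "?Q \<omega> \<le> ennreal c * ennreal \<theta>" using c \<theta>_pos by (simp add: ennreal_mult)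
        then have upper: "?Q \<omega> / ennreal c \<le> ennreal \<theta>"
          using c by (intro divide_le_posI_ennreal) auto
        have "ennreal (c / \<theta>) \<le> ?Q \<omega>"
        proof (cases "1 \<le> R / L")
          case True
          then have LS: "L * S = R" using L(1) unfolding S_def by simp
          have vS: "0 < r S" "0 < v S" using S growth_pos[OF v] growth_pos[OF r] by auto
          have "r S \<le> 1 / (20 * lam\<^sup>2) * r R" using L(2)[of S] S LS by simp
          then have "5 * lam\<^sup>2 * (r S / r R) \<le> 1 / 4" using lam2 vR by (simp add: field_simps)
          from Q.exit_time_ge_good[OF good(3,1) this]
          have Q: "ennreal (v S * r S / 2) \<le> ?Q \<omega>" .
          have "c \<le> D * (v S * r S)" using vr[of S] S LS unfolding c_def by simp
          also have "\<dots> \<le> \<theta> / 2 * (v S * r S)"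
            using \<theta> vS unfolding \<theta>\<^sub>0_def by (intro mult_right_mono) auto
          finally have "c / \<theta> \<le> v S * r S / 2" using \<theta>_pos by (simp add: field_simps)
          then show ?thesis using Q by (meson ennreal_leI order_trans)
        next
          case False
          then have "R \<le> L" using L(1) by simp
          then have "c \<le> v L * r L" unfolding c_def
            using R growth_mono[OF v, of R L] growth_mono[OF r, of R L] vR by (intro mult_mono) auto
          also have "\<dots> \<le> D" using vr[of 1] growth_1[OF v] growth_1[OF r] by simp
          finally have "c / \<theta> \<le> 1" using \<theta> D \<theta>_pos unfolding \<theta>\<^sub>0_def by simp
          then have "ennreal (c / \<theta>) \<le> ennreal 1" by (rule ennreal_leI)
          also have "\<dots> \<le> ?Q \<omega>" using Q.exit_time_ge_1[of R] R by simp
          finally show ?thesis .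
        qed
        then have "ennreal (c / \<theta>) / ennreal c \<le> ?Q \<omega> / ennreal c" by (rule divide_right_mono_ennreal)
        moreover have "ennreal (c / \<theta>) / ennreal c = ennreal (inverse \<theta>)"
          using c \<theta>_pos by (simp add: divide_ennreal inverse_eq_divide)
        ultimately show "\<omega> \<in> {\<omega> \<in> space M. ennreal (inverse \<theta>) \<le> ?Q \<omega> / ennreal c \<and> ?Q \<omega> / ennreal c \<le> ennreal \<theta>}"
          using upper \<omega>M by simp
      qed
    qed
    finally show "1 - 3 * \<delta> \<le> prob {\<omega> \<in> space M. ennreal (inverse \<theta>) \<le> ?Q \<omega> / ennreal (v R * r R) \<and> ?Q \<omega> / ennreal (v R * r R) \<le> ennreal \<theta>}"
      unfolding c_def .
  qed
qed

abbreviation scale :: "nat \<Rightarrow> real" where "scale n \<equiv> scale_inverse v r (real n)"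

lemma scale: "1 \<le> n \<Longrightarrow> 1 \<le> scale n" "1 \<le> n \<Longrightarrow> v (scale n) * r (scale n) = real n"
  using scale_inverse_props[OF v r constants(1,3), of "real n"] by simp_all

lemma prob_Good_Int: "1 \<le> R \<Longrightarrow> 1 \<le> S \<Longrightarrow> Good R \<inter> Good S \<in> events \<and> 1 - 2 * \<delta> \<le> prob (Good R \<inter> Good S)"
  using Good_sets[of R] Good_sets[of S] prob_Good[of R] prob_Good[of S] prob_Int_ge[of "Good R" "Good S"] by auto

lemma heat_kernel_tight:
  "\<exists>\<theta>\<^sub>0. \<forall>\<theta>\<ge>\<theta>\<^sub>0. \<forall>n\<ge>1. 1 - 3 * \<delta> \<le> prob {\<omega> \<in> space M.
     inverse \<theta> \<le> v (scale n) * heat_kernel (E \<omega>) (2 * n) (\<rho> \<omega>) (\<rho> \<omega>) \<and>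
     v (scale n) * heat_kernel (E \<omega>) (2 * n) (\<rho> \<omega>) (\<rho> \<omega>) \<le> \<theta>}"
proof -
  obtain L where L: "1 \<le> L" "\<And>x. 0 < x \<Longrightarrow> r x \<le> 1 / (12 * lam\<^sup>2) * r (L * x)"
    using growth_shrink[OF r, of "1 / (12 * lam\<^sup>2)"] constants lam by auto
  obtain D where D: "1 \<le> D" "\<And>x. 0 < x \<Longrightarrow> v (L * x) \<le> D * v x"
    using growth_expand[OF v L(1)] by auto
  define \<theta>\<^sub>0 where "\<theta>\<^sub>0 = max (7 * lam) (4 * lam * D)"
  show ?thesis
  proof (intro exI[of _ \<theta>\<^sub>0] allI impI)
    fix \<theta> :: real and n :: nat
    assume \<theta>: "\<theta>\<^sub>0 \<le> \<theta>" and n: "1 \<le> n"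
    have \<theta>_pos: "0 < \<theta>" using \<theta> lam unfolding \<theta>\<^sub>0_def by simp
    define S where "S = scale n"
    have S: "1 \<le> S" "v S * r S = real n" using scale[OF n] by (auto simp: S_def)
    have LS: "1 \<le> L * S" using L(1) S(1) mult_mono[of 1 L 1 S] by simp
    let ?q = "\<lambda>\<omega>. v S * heat_kernel (E \<omega>) (2 * n) (\<rho> \<omega>) (\<rho> \<omega>)"
    let ?H = "Good S \<inter> Good (L * S)"
    have "1 - 3 * \<delta> \<le> prob ?H" using prob_Good_Int[OF S(1) LS] \<delta> by simp
    also have "prob ?H \<le> prob {\<omega> \<in> space M. inverse \<theta> \<le> ?q \<omega> \<and> ?q \<omega> \<le> \<theta>}"
    proof (rule finite_measure_mono)
      show "{\<omega> \<in> space M. inverse \<theta> \<le> ?q \<omega> \<and> ?q \<omega> \<le> \<theta>} \<in> events" by measurable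
      show "?H \<subseteq> {\<omega> \<in> space M. inverse \<theta> \<le> ?q \<omega> \<and> ?q \<omega> \<le> \<theta>}"
      proof
        fix \<omega> assume \<omega>: "\<omega> \<in> ?H"
        then have \<omega>M: "\<omega> \<in> space M" by (simp add: Good_def)
        interpret Q: metric_rooted_graph "G \<omega>" "E \<omega>" "\<rho> \<omega>" "d \<omega>" v r "C\<^sub>1" "C\<^sub>2" "d\<^sub>1" "d\<^sub>2" "\<alpha>\<^sub>1" "\<alpha>\<^sub>2" lam
          by (rule quenched[OF \<omega>M])
        have good: "Q.good S" "Q.good (L * S)" using \<omega> by (auto simp: Good_def)
        let ?k = "Q.killed UNIV (2 * n) (\<rho> \<omega>)"
        have q: "?q \<omega> = v S * ?k" by (simp add: Q.heat_kernel_eq[OF Q.root])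
        have "v S * ?k \<le> 7 * lam" by (rule Q.heat_upper_good[OF good(1) n S(2)])
        then have upper: "?q \<omega> \<le> \<theta>" using \<theta> unfolding q \<theta>\<^sub>0_def by simp
        have lam2: "0 < lam\<^sup>2" using lam by simp
        have rL: "0 < r (L * S)" using LS growth_pos[OF r] by simp
        have "(1 - Q.stay (Q.rball (L * S)) n)\<^sup>2 \<le> (2 * 1 + 1) * lam\<^sup>2 * (r S / r (L * S))"
          by (rule Q.exit_probability_le_good[OF good]) (simp add: S(2))
        also have "\<dots> \<le> (1 / 2)\<^sup>2"
          using L(2)[of S] S(1) lam2 rL by (simp add: field_simps power2_eq_square)
        finally have "1 - Q.stay (Q.rball (L * S)) n \<le> 1 / 2" by (rule power2_le_imp_le) simp
        then have "1 / 2 \<le> Q.stay (Q.rball (L * S)) n" by simp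
        from Q.heat_lower_good[OF good(2) this]
        have "1 \<le> (4 * lam * ?k) * v (L * S)" by (simp add: mult_ac)
        also have "\<dots> \<le> (4 * lam * ?k) * (D * v S)"
          using D(2)[of S] S(1) lam Q.killed_nonneg[of UNIV "2 * n" "\<rho> \<omega>"] by (intro mult_left_mono) auto
        also have "\<dots> = (4 * lam * D) * (v S * ?k)" by (simp add: mult_ac)
        also have "\<dots> \<le> \<theta> * (v S * ?k)"
          using \<theta> S(1) growth_pos[OF v, of S] Q.killed_nonneg[of UNIV "2 * n" "\<rho> \<omega>"]
          unfolding \<theta>\<^sub>0_def by (intro mult_right_mono) auto
        finally have "inverse \<theta> \<le> ?q \<omega>" unfolding q using \<theta>_pos by (simp add: field_simps)
        then show "\<omega> \<in> {\<omega> \<in> space M. inverse \<theta> \<le> ?q \<omega> \<and> ?q \<omega> \<le> \<theta>}" using upper \<omega>M by simp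
      qed
    qed
    finally show "1 - 3 * \<delta> \<le> prob {\<omega> \<in> space M.
       inverse \<theta> \<le> v (scale n) * heat_kernel (E \<omega>) (2 * n) (\<rho> \<omega>) (\<rho> \<omega>) \<and>
       v (scale n) * heat_kernel (E \<omega>) (2 * n) (\<rho> \<omega>) (\<rho> \<omega>) \<le> \<theta>}" unfolding S_def .
  qed
qed

text \<open>
  \<open>(1 - \<delta>) (1 - 2 \<delta>) \<ge> 1 - 3 \<delta>\<close>, where \<open>2 \<delta>\<close> accounts for two radii that may fail to be good.
\<close>

lemma annealed_ge_Good:
  assumes A: "Measurable.pred (M \<Otimes>\<^sub>M path_space) (\<lambda>(\<omega>, w). P \<omega> w)" and H: "H \<in> events" "1 - 2 * \<delta> \<le> prob H"
    and P: "\<And>\<omega>. \<omega> \<in> H \<Longrightarrow> 1 - \<delta> \<le> measure (srw_law (E \<omega>) (\<rho> \<omega>)) {w. P \<omega> w}"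
  shows "1 - 3 * \<delta> \<le> \<P>((\<omega>, w) in annealed_law M E \<rho>. P \<omega> w)"
proof -
  let ?A = "{(\<omega>, w) \<in> space (annealed_law M E \<rho>). P \<omega> w}"
  have eq: "?A = {x \<in> space (M \<Otimes>\<^sub>M path_space). case x of (\<omega>, w) \<Rightarrow> P \<omega> w}"
    by (auto simp: space_annealed space_pair_measure)
  have "1 - 3 * \<delta> \<le> (1 - \<delta>) * (1 - 2 * \<delta>)" using \<delta> by (simp add: algebra_simps)
  also have "\<dots> \<le> (1 - \<delta>) * prob H" using \<delta> H by (intro mult_left_mono) auto
  also have "\<dots> \<le> measure (annealed_law M E \<rho>) ?A"
  proof (rule annealed_ge[OF _ H(1)])
    show "?A \<in> sets (M \<Otimes>\<^sub>M path_space)" unfolding eq using A by (simp add: pred_def)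
    show "1 - \<delta> \<le> measure (srw_law (E \<omega>) (\<rho> \<omega>)) {w. (\<omega>, w) \<in> ?A}" if "\<omega> \<in> H" for \<omega>
      using P[OF that] sets.sets_into_space[OF H(1)] that by (auto simp: space_annealed)
  qed (use \<delta> in simp)
  finally show ?thesis .
qed

lemma displacement_upper:
  "\<exists>\<theta>\<^sub>0. \<forall>\<theta>\<ge>\<theta>\<^sub>0. \<forall>n\<ge>1. 1 - 3 * \<delta> \<le>
     \<P>((\<omega>, w) in annealed_law M E \<rho>. d \<omega> (\<rho> \<omega>) (w n) / scale n < \<theta>)"
proof -
  have "0 < \<delta>\<^sup>2 / (3 * lam\<^sup>2)" using \<delta> lam by simp
  from growth_shrink[OF r constants(2,4) this]
  obtain L where L: "1 \<le> L" "\<And>K x. L \<le> K \<Longrightarrow> 0 < x \<Longrightarrow> r x \<le> \<delta>\<^sup>2 / (3 * lam\<^sup>2) * r (K * x)" by auto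
  show ?thesis
  proof (intro exI[of _ L] allI impI)
    fix \<theta> :: real and n :: nat
    assume \<theta>: "L \<le> \<theta>" and n: "1 \<le> n"
    define S where "S = scale n"
    have S: "1 \<le> S" "v S * r S = real n" using scale[OF n] by (auto simp: S_def)
    have \<theta>S: "1 \<le> \<theta> * S" using \<theta> L(1) S(1) mult_mono[of 1 \<theta> 1 S] by simp
    show "1 - 3 * \<delta> \<le> \<P>((\<omega>, w) in annealed_law M E \<rho>. d \<omega> (\<rho> \<omega>) (w n) / scale n < \<theta>)"
      unfolding S_def[symmetric]
    proof (rule annealed_ge_Good[where H="Good S \<inter> Good (\<theta> * S)"])
      show "Measurable.pred (M \<Otimes>\<^sub>M path_space) (\<lambda>(\<omega>, w). d \<omega> (\<rho> \<omega>) (w n) / S < \<theta>)"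
        using measurable_dist_root[of n] unfolding case_prod_beta by measurable
      fix \<omega> assume \<omega>: "\<omega> \<in> Good S \<inter> Good (\<theta> * S)"
      then have \<omega>M: "\<omega> \<in> space M" by (simp add: Good_def)
      interpret Q: metric_rooted_graph "G \<omega>" "E \<omega>" "\<rho> \<omega>" "d \<omega>" v r "C\<^sub>1" "C\<^sub>2" "d\<^sub>1" "d\<^sub>2" "\<alpha>\<^sub>1" "\<alpha>\<^sub>2" lam
        by (rule quenched[OF \<omega>M])
      interpret W: prob_space "srw_law (E \<omega>) (\<rho> \<omega>)" by (rule prob_space_srw_law)
      have good: "Q.good S" "Q.good (\<theta> * S)" using \<omega> by (auto simp: Good_def)
      have lam2: "0 < lam\<^sup>2" using lam by simp
      have r\<theta>: "0 < r (\<theta> * S)" using \<theta>S growth_pos[OF r] by simp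
      have "(1 - Q.stay (Q.rball (\<theta> * S)) n)\<^sup>2 \<le> (2 * 1 + 1) * lam\<^sup>2 * (r S / r (\<theta> * S))"
        by (rule Q.exit_probability_le_good[OF good]) (simp add: S(2))
      also have "\<dots> \<le> (2 * 1 + 1) * lam\<^sup>2 * (\<delta>\<^sup>2 / (3 * lam\<^sup>2))"
        using L(2)[OF \<theta>, of S] S(1) r\<theta> by (intro mult_left_mono) (simp_all add: pos_divide_le_eq)
      also have "\<dots> = \<delta>\<^sup>2" using lam2 by simp
      finally have "1 - Q.stay (Q.rball (\<theta> * S)) n \<le> \<delta>" by (rule power2_le_imp_le) (use \<delta> in simp)
      then have "1 - \<delta> \<le> W.prob {w. w n \<in> Q.rball (\<theta> * S)}"
        using Q.stay_le_walk_in[of "Q.rball (\<theta> * S)" n] by linarith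
      also have "\<dots> \<le> W.prob {w. d \<omega> (\<rho> \<omega>) (w n) / S < \<theta>}"
      proof (rule W.finite_measure_mono)
        show "{w. d \<omega> (\<rho> \<omega>) (w n) / S < \<theta>} \<in> W.events"
          unfolding sets_srw_law by (rule sets_walk_at[where Q="\<lambda>x. d \<omega> (\<rho> \<omega>) x / S < \<theta>"])
        show "{w. w n \<in> Q.rball (\<theta> * S)} \<subseteq> {w. d \<omega> (\<rho> \<omega>) (w n) / S < \<theta>}"
          using S(1) by (auto simp: pos_divide_less_eq)
      qed
      finally show "1 - \<delta> \<le> W.prob {w. d \<omega> (\<rho> \<omega>) (w n) / S < \<theta>}" .
    qed (use prob_Good_Int[OF S(1) \<theta>S] in \<open>simp_all only:\<close>)
  qed
qed

lemma displacement_lower: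
  "\<exists>\<theta>\<^sub>0. \<forall>\<theta>\<ge>\<theta>\<^sub>0. \<forall>n\<ge>1. 1 - 3 * \<delta> \<le>
     \<P>((\<omega>, w) in annealed_law M E \<rho>. inverse \<theta> < (1 + d \<omega> (\<rho> \<omega>) (w n)) / scale n)"
proof -
  have "0 < \<delta>\<^sup>2 / (7 * lam\<^sup>2)" and "0 < d\<^sub>1" using \<delta> lam constants(3) by simp_all
  from growth_shrink[OF v constants(1) this(2,1)]
  obtain L where L: "1 \<le> L" "\<And>K x. L \<le> K \<Longrightarrow> 0 < x \<Longrightarrow> v x \<le> \<delta>\<^sup>2 / (7 * lam\<^sup>2) * v (K * x)" by auto
  show ?thesis
  proof (intro exI[of _ L] allI impI)
    fix \<theta> :: real and n :: nat
    assume \<theta>: "L \<le> \<theta>" and n: "1 \<le> n"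
    define S where "S = scale n"
    have S: "1 \<le> S" "v S * r S = real n" using scale[OF n] by (auto simp: S_def)
    have \<theta>_pos: "0 < \<theta>" using \<theta> L(1) by simp
    \<comment> \<open>The unit added to the distance settles the case \<open>S / \<theta> < 1\<close>, in which \<open>B(S / \<theta>)\<close> need not be good.\<close>
    define R where "R = max 1 (S / \<theta>)"
    have R: "1 \<le> R" by (simp add: R_def)
    show "1 - 3 * \<delta> \<le> \<P>((\<omega>, w) in annealed_law M E \<rho>. inverse \<theta> < (1 + d \<omega> (\<rho> \<omega>) (w n)) / scale n)"
      unfolding S_def[symmetric]
    proof (rule annealed_ge_Good[where H="Good S \<inter> Good R"])
      show "Measurable.pred (M \<Otimes>\<^sub>M path_space) (\<lambda>(\<omega>, w). inverse \<theta> < (1 + d \<omega> (\<rho> \<omega>) (w n)) / S)"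
        using measurable_dist_root[of n] unfolding case_prod_beta by measurable
      fix \<omega> assume \<omega>: "\<omega> \<in> Good S \<inter> Good R"
      then have \<omega>M: "\<omega> \<in> space M" by (simp add: Good_def)
      interpret Q: metric_rooted_graph "G \<omega>" "E \<omega>" "\<rho> \<omega>" "d \<omega>" v r "C\<^sub>1" "C\<^sub>2" "d\<^sub>1" "d\<^sub>2" "\<alpha>\<^sub>1" "\<alpha>\<^sub>2" lam
        by (rule quenched[OF \<omega>M])
      interpret W: prob_space "srw_law (E \<omega>) (\<rho> \<omega>)" by (rule prob_space_srw_law)
      have good: "Q.good S" "Q.good R" using \<omega> by (auto simp: Good_def)
      have lam2: "0 < lam\<^sup>2" using lam by simp
      let ?far = "{w. inverse \<theta> < (1 + d \<omega> (\<rho> \<omega>) (w n)) / S}"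
      have far_event: "?far \<in> W.events"
        unfolding sets_srw_law by (rule sets_walk_at[where Q="\<lambda>x. inverse \<theta> < (1 + d \<omega> (\<rho> \<omega>) x) / S"])
      have far: "inverse \<theta> < (1 + d \<omega> (\<rho> \<omega>) x) / S \<longleftrightarrow> S / \<theta> < 1 + d \<omega> (\<rho> \<omega>) x" for x
        using S(1) \<theta>_pos by (simp add: field_simps)
      have events: "{w. w n \<in> A} \<in> W.events" for A unfolding sets_srw_law by (rule sets_walk_at)
      show "1 - \<delta> \<le> W.prob ?far"
      proof (cases "1 \<le> S / \<theta>")
        case True
        then have RS: "\<theta> * R = S" using \<theta>_pos by (simp add: R_def)
        have vS: "0 < v S" using S(1) growth_pos[OF v] by simp
        have "(W.prob {w. w n \<in> Q.rball R})\<^sup>2 \<le> 7 * lam\<^sup>2 * (v R / v S)"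
          by (rule Q.walk_in_ball_le_good[OF good(2,1) n S(2)])
        also have "\<dots> \<le> 7 * lam\<^sup>2 * (\<delta>\<^sup>2 / (7 * lam\<^sup>2))"
          using L(2)[OF \<theta>, of R] R RS vS by (intro mult_left_mono) (simp_all add: pos_divide_le_eq)
        also have "\<dots> = \<delta>\<^sup>2" using lam2 by simp
        finally have near: "W.prob {w. w n \<in> Q.rball R} \<le> \<delta>" by (rule power2_le_imp_le) (use \<delta> in simp)
        have "{w. w n \<in> Q.rball R} \<subseteq> {w. w n \<in> G \<omega>}" using Q.mball_subset_mspace by blast
        from W.finite_measure_Diff[OF events events this]
        have "1 - W.prob {w. w n \<in> Q.rball R} = W.prob ({w. w n \<in> G \<omega>} - {w. w n \<in> Q.rball R})"
          using Q.walk_in_graph[of n] by simp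
        also have "\<dots> \<le> W.prob ?far"
        proof (rule W.finite_measure_mono[OF subsetI far_event])
          fix w assume w: "w \<in> {w. w n \<in> G \<omega>} - {w. w n \<in> Q.rball R}"
          then have "R \<le> d \<omega> (\<rho> \<omega>) (w n)" using Q.root by auto
          then show "w \<in> ?far" using True unfolding R_def mem_Collect_eq far by simp
        qed
        finally show ?thesis using near by linarith
      next
        case False
        have "1 = W.prob {w. w n \<in> G \<omega>}" using Q.walk_in_graph[of n] by simp
        also have "\<dots> \<le> W.prob ?far"
        proof (rule W.finite_measure_mono[OF subsetI far_event])
          fix w assume "w \<in> {w. w n \<in> G \<omega>}"
          then have "0 \<le> d \<omega> (\<rho> \<omega>) (w n)" by simp
          then show "w \<in> ?far" using False unfolding mem_Collect_eq far by linarith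
        qed
        finally show ?thesis using \<delta> by simp
      qed
    qed (use prob_Good_Int[OF S(1) R] in \<open>simp_all only:\<close>)
  qed
qed

end

text \<open>
  Probabilities are at most \<open>1\<close>, so only lower bounds have to be uniform.
\<close>

lemma uniform_limit_1I:
  fixes f :: "real \<Rightarrow> 'b \<Rightarrow> real"
  assumes "\<And>e. 0 < e \<Longrightarrow> \<exists>\<theta>\<^sub>0. \<forall>\<theta>\<ge>\<theta>\<^sub>0. \<forall>x\<in>X. 1 - e < f \<theta> x" and "\<And>\<theta> x. f \<theta> x \<le> 1"
  shows "uniform_limit X f (\<lambda>_. 1) at_top"
proof (rule uniform_limitI)
  fix e :: real assume "0 < e"
  then obtain \<theta>\<^sub>0 where "\<And>\<theta> x. \<theta>\<^sub>0 \<le> \<theta> \<Longrightarrow> x \<in> X \<Longrightarrow> 1 - e < f \<theta> x" using assms(1) by blast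
  moreover have "\<bar>f \<theta> x - 1\<bar> = 1 - f \<theta> x" for \<theta> x using assms(2)[of \<theta> x] by simp
  ultimately have "\<forall>x\<in>X. dist (f \<theta> x) 1 < e" if "\<theta>\<^sub>0 \<le> \<theta>" for \<theta>
    using that by (force simp: dist_real_def)
  then show "\<forall>\<^sub>F \<theta> in at_top. \<forall>x\<in>X. dist (f \<theta> x) 1 < e"
    unfolding eventually_at_top_linorder by blast
qed

theorem proposition1p3:
  fixes M :: "'w measure"
    and G :: "'w \<Rightarrow> ('v :: countable) set"
    and E :: "'w \<Rightarrow> 'v set set"
    and d :: "'w \<Rightarrow> 'v \<Rightarrow> 'v \<Rightarrow> real"
    and \<rho> :: "'w \<Rightarrow> 'v"
    and v r p :: "real \<Rightarrow> real"
    and C\<^sub>1 C\<^sub>2 d\<^sub>1 d\<^sub>2 \<alpha>\<^sub>1 \<alpha>\<^sub>2 lam0 :: real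
  assumes random_graph: "random_rooted_graph M G E d \<rho>"
    and constants: "1 \<le> C\<^sub>1" "1 \<le> C\<^sub>2" "1 \<le> d\<^sub>1" "d\<^sub>1 \<le> d\<^sub>2" "0 < \<alpha>\<^sub>1" "\<alpha>\<^sub>1 \<le> \<alpha>\<^sub>2" "\<alpha>\<^sub>2 \<le> 1"
    and v_growth: "growth_function v C\<^sub>1 d\<^sub>1 d\<^sub>2"
    and r_growth: "growth_function r C\<^sub>2 \<alpha>\<^sub>1 \<alpha>\<^sub>2"
    and "1 < lam0"
    and p_lim: "(p \<longlongrightarrow> 0) at_top"
    and good: "\<And>R lam. 1 \<le> R \<Longrightarrow> lam0 \<le> lam \<Longrightarrow>
      \<P>(\<omega> in M. R \<in> good_radii (G \<omega>) (E \<omega>) (d \<omega>) (\<rho> \<omega>) v r lam) \<ge> 1 - p lam"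
  shows "uniform_limit {1..}
      (\<lambda>\<theta> R. \<P>(\<omega> in M.
         ennreal (inverse \<theta>)
           \<le> expected_exit_time (G \<omega>) (E \<omega>) (d \<omega>) (\<rho> \<omega>) R / ennreal (v R * r R) \<and>
         expected_exit_time (G \<omega>) (E \<omega>) (d \<omega>) (\<rho> \<omega>) R / ennreal (v R * r R)
           \<le> ennreal \<theta>))
      (\<lambda>_. 1) at_top \<and>
    uniform_limit {1..}
      (\<lambda>\<theta> n. \<P>(\<omega> in M.
         inverse \<theta> \<le> v (scale_inverse v r (real n))
                        * heat_kernel (E \<omega>) (2 * n) (\<rho> \<omega>) (\<rho> \<omega>) \<and>
         v (scale_inverse v r (real n))
           * heat_kernel (E \<omega>) (2 * n) (\<rho> \<omega>) (\<rho> \<omega>) \<le> \<theta>))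
      (\<lambda>_. 1) at_top \<and>
    uniform_limit {1..}
      (\<lambda>\<theta> n. \<P>((\<omega>, w) in annealed_law M E \<rho>.
         d \<omega> (\<rho> \<omega>) (w n) / scale_inverse v r (real n) < \<theta>))
      (\<lambda>_. 1) at_top \<and>
    uniform_limit {1..}
      (\<lambda>\<theta> n. \<P>((\<omega>, w) in annealed_law M E \<rho>.
         inverse \<theta> < (1 + d \<omega> (\<rho> \<omega>) (w n)) / scale_inverse v r (real n)))
      (\<lambda>_. 1) at_top"
proof -
  interpret random_rooted_graph M G E d \<rho> by (rule random_graph)
  interpret annealed: prob_space "annealed_law M E \<rho>" by (rule prob_space_annealed)
  have good_graph: "\<exists>lam \<delta>. 3 * \<delta> < e \<and> good_random_graph M G E d \<rho> v r C\<^sub>1 C\<^sub>2 d\<^sub>1 d\<^sub>2 \<alpha>\<^sub>1 \<alpha>\<^sub>2 lam \<delta>"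
    if "0 < e" for e
  proof -
    define \<delta> where "\<delta> = min (e / 4) (1 / 2)"
    have \<delta>: "0 < \<delta>" "\<delta> < 1" "3 * \<delta> < e" using that by (auto simp: \<delta>_def)
    have "\<forall>\<^sub>F lam in at_top. p lam < \<delta>" using order_tendstoD(2)[OF p_lim \<delta>(1)] .
    then have "\<forall>\<^sub>F lam in at_top. p lam < \<delta> \<and> lam0 \<le> lam"
      using eventually_ge_at_top by (rule eventually_conj)
    then obtain lam where lam: "p lam < \<delta>" "lam0 \<le> lam" by (metis (mono_tags, lifting) eventually_happens trivial_limit_at_top_linorder)
    have "good_random_graph M G E d \<rho> v r C\<^sub>1 C\<^sub>2 d\<^sub>1 d\<^sub>2 \<alpha>\<^sub>1 \<alpha>\<^sub>2 lam \<delta>"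
    proof (intro good_random_graph.intro random_graph good_random_graph_axioms.intro)
      show "1 - \<delta> \<le> prob {\<omega> \<in> space M. R \<in> good_radii (G \<omega>) (E \<omega>) (d \<omega>) (\<rho> \<omega>) v r lam}" if "1 \<le> R" for R
        using good[OF that lam(2)] lam(1) by simp
    qed (use v_growth r_growth constants \<delta> lam \<open>1 < lam0\<close> in auto)
    with \<delta>(3) show ?thesis by blast
  qed
  show ?thesis
  proof (intro conjI uniform_limit_1I prob_le_1 annealed.prob_le_1)
    fix e :: real assume "0 < e"
    from good_graph[OF this] obtain lam \<delta> where e: "3 * \<delta> < e"
      and "good_random_graph M G E d \<rho> v r C\<^sub>1 C\<^sub>2 d\<^sub>1 d\<^sub>2 \<alpha>\<^sub>1 \<alpha>\<^sub>2 lam \<delta>" by blast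
    then interpret good_random_graph M G E d \<rho> v r "C\<^sub>1" "C\<^sub>2" "d\<^sub>1" "d\<^sub>2" "\<alpha>\<^sub>1" "\<alpha>\<^sub>2" lam \<delta> by simp
    have weaken: "\<exists>\<theta>\<^sub>0. \<forall>\<theta>\<ge>\<theta>\<^sub>0. \<forall>x\<in>{1..}. 1 - e < f \<theta> x"
      if "\<exists>\<theta>\<^sub>0. \<forall>\<theta>\<ge>\<theta>\<^sub>0. \<forall>x\<ge>1. 1 - 3 * \<delta> \<le> f \<theta> x" for f :: "real \<Rightarrow> 'b :: {ord, one} \<Rightarrow> real"
      using that e by (meson atLeast_iff diff_strict_left_mono less_le_trans)
    show "\<exists>\<theta>\<^sub>0. \<forall>\<theta>\<ge>\<theta>\<^sub>0. \<forall>R\<in>{1..}. 1 - e < prob {\<omega> \<in> space M.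
        ennreal (inverse \<theta>) \<le> expected_exit_time (G \<omega>) (E \<omega>) (d \<omega>) (\<rho> \<omega>) R / ennreal (v R * r R) \<and>
        expected_exit_time (G \<omega>) (E \<omega>) (d \<omega>) (\<rho> \<omega>) R / ennreal (v R * r R) \<le> ennreal \<theta>}"
      by (rule weaken[OF exit_time_tight])
    show "\<exists>\<theta>\<^sub>0. \<forall>\<theta>\<ge>\<theta>\<^sub>0. \<forall>n\<in>{1..}. 1 - e < prob {\<omega> \<in> space M.
        inverse \<theta> \<le> v (scale n) * heat_kernel (E \<omega>) (2 * n) (\<rho> \<omega>) (\<rho> \<omega>) \<and>
        v (scale n) * heat_kernel (E \<omega>) (2 * n) (\<rho> \<omega>) (\<rho> \<omega>) \<le> \<theta>}"
      by (rule weaken[OF heat_kernel_tight])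
    show "\<exists>\<theta>\<^sub>0. \<forall>\<theta>\<ge>\<theta>\<^sub>0. \<forall>n\<in>{1..}. 1 - e <
        \<P>((\<omega>, w) in annealed_law M E \<rho>. d \<omega> (\<rho> \<omega>) (w n) / scale n < \<theta>)"
      by (rule weaken[OF displacement_upper])
    show "\<exists>\<theta>\<^sub>0. \<forall>\<theta>\<ge>\<theta>\<^sub>0. \<forall>n\<in>{1..}. 1 - e <
        \<P>((\<omega>, w) in annealed_law M E \<rho>. inverse \<theta> < (1 + d \<omega> (\<rho> \<omega>) (w n)) / scale n)"
      by (rule weaken[OF displacement_lower])
  qed
qed

end
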